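(* Let $(X,d)$ be a discrete metric space of bounded geometry. If the associated coarse groupoid $G(X)$ has subexponential dynamic asymptotic dimension growth, then $G(X)$ is amenable.
   Context: Bounded geometry: for every $r>0$ there is $n_r\in\mathbb{N}$ such that every ball $B(x,r)$ has at most $n_r$ elements. Coarse groupoid: for $R\ge 0$ let $E_R=\{(x,y)\in X\times X\mid d(x,y)\le R\}$. As a set $G(X)=\bigcup_{R\ge0}\overline{E_R}$, closures taken in the Stone–Čech compactification $\beta(X\times X)$, with the weak topology coming from this union (so each $\overline{E_R}$ is compact open). The groupoid operations are the continuous extensions of those of the pair groupoid $X\times X$: $r(x,y)=x$, $s(x,y)=y$, $(x,y)(y,z)=(x,z)$, $(x,y)^{-1}=(y,x)$; the unit space is $\overline{E_0}\cong\beta X$. $G(X)$ is a $\sigma$-compact locally compact Hausdorff étale groupoid with compact unit space. Its canonical length function $\ell:G(X)\to[0,\infty)$ is the restriction to $G(X)$ of the continuous extension of $d:X\times X\to[0,\infty]$ to $\beta(X\times X)$. Dynamic asymptotic dimension function: for an étale groupoid $\mathcal{G}$ with compact unit space $\mathcal{G}^{(0)}$ and length function $\ell$ (for $\mathcal{G}=G(X)$, the canonical one), and $R>0$, $\mathrm{dad}_{\mathcal{G}}(R)$ is the smallest $m\in\mathbb{N}$ such that, with $K=\{z\in\mathcal{G}\mid\ell(z)<R\}$, there is an open cover $\{U_0,\dots,U_m\}$ of $\mathcal{G}^{(0)}$ such that for each $i$ the set $\{g\in K\mid s(g),r(g)\in U_i\}$ is contained in a precompact (i.e. with compact closure in $\mathcal{G}$)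 subgroupoid of $\mathcal{G}$. Growth: for $f,g:\mathbb{R}^{+}\to\mathbb{R}^{+}$ write $f\preceq g$ if there is $k\in\mathbb{N}$ with $f(x)\le k\,g(kx+k)+k$ for all $x>k$. A monotone increasing $f:\mathbb{R}^+\to\mathbb{R}^+$ has subexponential growth if $\lim_{t\to\infty}f(t)/b^{t}=0$ for every $b>1$. $\mathcal{G}$ has subexponential dynamic asymptotic dimension growth if $\mathrm{dad}_{\mathcal{G}}\preceq f$ for some $f$ of subexponential growth. Amenability: with $\mathcal{G}_x=s^{-1}(x)$, a locally compact Hausdorff étale groupoid $\mathcal{G}$ is amenable if for all compact $K\subseteq\mathcal{G}$ and all $\varepsilon>0$ there is a continuous, compactly supported $\mu:\mathcal{G}\to[0,1]$ such that (1) $\sum_{g\in\mathcal{G}_x}\mu(g)\le1$ for all $x\in\mathcal{G}^{(0)}$; (2) $|1-\sum_{g\in\mathcal{G}_{r(k)}}\mu(g)|<\varepsilon$ for all $k\in K$; (3) $\sum_{g\in\mathcal{G}_{r(k)}}|\mu(g)-\mu(gk)|<\varepsilon$ for all $k\in K$. *)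

theory Defs
  imports "HOL-Analysis.Analysis" "HOL-Library.Extended_Nat"
begin

section \<open>The Stone--Cech compactification of a discrete space\<close>

text \<open>
  The Stone--Cech compactification of a set \<open>S\<close> with the discrete topology is the space of
  ultrafilters on \<open>S\<close>. An ultrafilter on \<open>S\<close> is represented by a filter on the ambient type that
  contains \<open>S\<close>.
\<close>

definition is_ultrafilter :: "'a filter \<Rightarrow> bool" where
  "is_ultrafilter F \<longleftrightarrow>
     F \<noteq> bot \<and> (\<forall>P. eventually P F \<or> eventually (\<lambda>x. \<not> P x) F)"

definition beta_set :: "'a set \<Rightarrow> 'a filter set" where
  "beta_set A = {F. is_ultrafilter F \<and> eventually (\<lambda>x. x \<in> A) F}"

definition beta :: "'a set \<Rightarrow> 'a filter topology" where
  "beta S = topology_generated_by {beta_set A | A. A \<subseteq> S}"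

definition beta_point :: "'a \<Rightarrow> 'a filter" where
  "beta_point x = principal {x}"

text \<open>
  The extension of \<open>f\<close> to \<open>T\<close>, where \<open>D\<close> is embedded in \<open>T\<close> as a dense subset by \<open>\<iota>\<close>; it is unique
  when \<open>Y\<close> is Hausdorff.
\<close>

definition continuous_extension ::
    "'a topology \<Rightarrow> ('i \<Rightarrow> 'a) \<Rightarrow> 'i set \<Rightarrow> 'b topology \<Rightarrow> ('i \<Rightarrow> 'b) \<Rightarrow> 'a \<Rightarrow> 'b" where
  "continuous_extension T \<iota> D Y f =
     (THE g. g \<in> extensional (topspace T) \<and> continuous_map T Y g \<and> (\<forall>p\<in>D. g (\<iota> p) = f p))"


subsection \<open>Compactness, density and the universal property\<close>

lemma ultra_not: "is_ultrafilter F \<Longrightarrow> eventually (\<lambda>x. \<not> P x) F \<longleftrightarrow> \<not> eventually P F"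
proof -
  assume F: "is_ultrafilter F"
  have "\<not> (eventually P F \<and> eventually (\<lambda>x. \<not> P x) F)"
    unfolding eventually_conj_iff[symmetric] using F by (simp add: is_ultrafilter_def)
  with F show ?thesis by (auto simp: is_ultrafilter_def)
qed

lemma ultra_max: assumes "is_ultrafilter F" "G \<le> F" "G \<noteq> bot" shows "G = F"
proof (rule antisym)
  show "F \<le> G"
    unfolding le_filter_def
  proof (intro allI impI)
    fix P assume P: "eventually P G"
    show "eventually P F"
    proof (rule ccontr)
      assume "\<not> eventually P F"
      then have "eventually (\<lambda>x. \<not> P x) G" using assms ultra_not[of F P] by (auto simp: le_filter_def)
      then have "eventually (\<lambda>x. False) G" using P by eventually_elim auto
      then show False using assms(3) by (simp add: trivial_limit_def)
    qed
  qed
qed (use assms in auto)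

lemma ultra_extends:
  fixes F :: "'a filter"
  assumes F: "F \<noteq> bot"
  shows "\<exists>U\<le>F. is_ultrafilter U"
proof -
  let ?A = "{G. G \<noteq> bot \<and> G \<le> F}"
  let ?P = "\<lambda>a b. b \<le> (a :: 'a filter)"
  have "\<exists>m\<in>?A. \<forall>a\<in>?A. ?P m a \<longrightarrow> a = m"
  proof (rule predicate_Zorn)
    show "partial_order_on ?A (relation_of ?P ?A)"
      by (rule partial_order_on_relation_ofI) auto
    fix C assume C: "C \<in> Chains (relation_of ?P ?A)"
    show "\<exists>u\<in>?A. \<forall>a\<in>C. ?P a u"
    proof (cases "C = {}")
      case True then show ?thesis using F by auto
    next
      case False
      have sub: "C \<subseteq> ?A" using C by (auto simp: Chains_def relation_of_def)
      have "Inf C = bot \<longleftrightarrow> (\<exists>x\<in>C. x = bot)"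
        unfolding trivial_limit_def using False C
        by (intro eventually_Inf_base) (auto simp: Chains_def relation_of_def)
      then have "Inf C \<noteq> bot" using sub by auto
      moreover have "Inf C \<le> F" using False sub by (metis (mono_tags, lifting) Inf_lower2 ex_in_conv mem_Collect_eq subsetD)
      ultimately show ?thesis by (intro bexI[of _ "Inf C"]) (auto intro: Inf_lower)
    qed
  qed
  then obtain U where U: "U \<noteq> bot" "U \<le> F" and max: "\<And>G. G \<noteq> bot \<Longrightarrow> G \<le> U \<Longrightarrow> G = U"
    by (auto intro: order_trans)
  have "is_ultrafilter U"
    unfolding is_ultrafilter_def
  proof (intro conjI allI)
    fix P
    show "eventually P U \<or> eventually (\<lambda>x. \<not> P x) U"
    proof (rule disjCI)
      assume "\<not> eventually (\<lambda>x. \<not> P x) U"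
      then have "inf U (principal {x. P x}) \<noteq> bot"
        by (simp only: trivial_limit_def eventually_inf_principal) simp
      then have "inf U (principal {x. P x}) = U" by (rule max) simp
      moreover have "eventually P (inf U (principal {x. P x}))" by (simp add: eventually_inf_principal)
      ultimately show "eventually P U" by simp
    qed
  qed (rule U)
  with U show ?thesis by auto
qed

lemma beta_setD: "F \<in> beta_set A \<Longrightarrow> is_ultrafilter F" by (simp add: beta_set_def)

lemma eventually_beta_point [simp]: "eventually P (beta_point x) \<longleftrightarrow> P x"
  by (simp add: beta_point_def eventually_principal)

lemma beta_point_not_bot [simp]: "beta_point x \<noteq> bot"
  by (simp add: beta_point_def principal_eq_bot_iff)

lemma beta_point_in_iff [simp]: "beta_point x \<in> beta_set A \<longleftrightarrow> x \<in> A"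
  by (auto simp: beta_set_def is_ultrafilter_def)

lemma beta_set_mono:
  assumes "A \<subseteq> B"
  shows "beta_set A \<subseteq> beta_set B"
proof
  fix F assume F: "F \<in> beta_set A"
  have "eventually (\<lambda>x. x \<in> B) F"
    by (rule eventually_mono[of "\<lambda>x. x \<in> A"]) (use F assms in \<open>auto simp: beta_set_def\<close>)
  with F show "F \<in> beta_set B" by (simp add: beta_set_def)
qed

lemma beta_set_Int: "beta_set (A \<inter> B) = beta_set A \<inter> beta_set B"
  by (auto simp: beta_set_def eventually_conj_iff)

lemma beta_set_Diff: "beta_set (A - B) = beta_set A - beta_set B"
  by (auto simp: beta_set_def eventually_conj_iff ultra_not)

lemma beta_set_empty [simp]: "beta_set {} = {}"
  by (auto simp: beta_set_def is_ultrafilter_def)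

lemma beta_set_Un: "beta_set (A \<union> B) = beta_set A \<union> beta_set B"
proof -
  have "(A \<union> B) = UNIV - ((UNIV - A) \<inter> (UNIV - B))" by auto
  then have "beta_set (A \<union> B) = beta_set UNIV - ((beta_set UNIV - beta_set A) \<inter> (beta_set UNIV - beta_set B))"
    by (simp only: beta_set_Diff beta_set_Int)
  also have "\<dots> = beta_set A \<union> beta_set B" by (auto simp: beta_set_def)
  finally show ?thesis .
qed

lemma beta_set_UN: "finite I \<Longrightarrow> beta_set (\<Union>i\<in>I. A i) = (\<Union>i\<in>I. beta_set (A i))"
  by (induction I rule: finite_induct) (auto simp: beta_set_Un)

lemma beta_set_eq_iff: 
  assumes "F \<in> beta_set S" "G \<in> beta_set S" "\<And>A. A \<subseteq> S \<Longrightarrow> F \<in> beta_set A \<Longrightarrow> G \<in> beta_set A"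
  shows "F = G"
proof -
  have "G \<le> F"
    unfolding le_filter_def
  proof (intro allI impI)
    fix P assume "eventually P F"
    then have "F \<in> beta_set {x\<in>S. P x}" using assms(1) by (simp add: beta_set_def eventually_conj_iff)
    then have "G \<in> beta_set {x\<in>S. P x}" by (rule assms(3)[rotated]) simp
    then show "eventually P G" by (simp add: beta_set_def eventually_conj_iff)
  qed
  then show ?thesis using ultra_max[of F G] assms(1,2) by (auto simp: beta_set_def is_ultrafilter_def)
qed

lemma topspace_beta [simp]: "topspace (beta S) = beta_set S"
proof -
  have "\<Union>{beta_set A | A. A \<subseteq> S} = beta_set S"
  proof (rule antisym)
    show "\<Union>{beta_set A | A. A \<subseteq> S} \<subseteq> beta_set S"
    proof (rule Union_least)
      fix T assume "T \<in> {beta_set A | A. A \<subseteq> S}"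
      then obtain A where "T = beta_set A" "A \<subseteq> S" by (elim CollectE exE conjE)
      then show "T \<subseteq> beta_set S" by (simp add: beta_set_mono)
    qed
    show "beta_set S \<subseteq> \<Union>{beta_set A | A. A \<subseteq> S}"
      by (rule Union_upper, rule CollectI, rule exI[of _ S]) simp
  qed
  then show ?thesis unfolding beta_def topology_generated_by_topspace .
qed

lemma openin_beta_set: "A \<subseteq> S \<Longrightarrow> openin (beta S) (beta_set A)"
  unfolding beta_def by (rule topology_generated_by_Basis, rule CollectI, rule exI[of _ A]) simp

lemma openin_beta:
  "openin (beta S) U \<longleftrightarrow> (\<forall>F\<in>U. \<exists>A\<subseteq>S. F \<in> beta_set A \<and> beta_set A \<subseteq> U)"
proof
  assume "openin (beta S) U"
  then have "generate_topology_on {beta_set A |A. A \<subseteq> S} U"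
    unfolding beta_def by (rule openin_topology_generated_by)
  then show "\<forall>F\<in>U. \<exists>A\<subseteq>S. F \<in> beta_set A \<and> beta_set A \<subseteq> U"
  proof induction
    case Empty
    then show ?case by simp
  next
    case (Int a b)
    show ?case
    proof
      fix F assume F: "F \<in> a \<inter> b"
      from Int.IH(1)[THEN bspec, of F] F obtain A where A: "A \<subseteq> S" "F \<in> beta_set A" "beta_set A \<subseteq> a"
        by auto
      from Int.IH(2)[THEN bspec, of F] F obtain B where B: "F \<in> beta_set B" "beta_set B \<subseteq> b"
        by auto
      show "\<exists>A\<subseteq>S. F \<in> beta_set A \<and> beta_set A \<subseteq> a \<inter> b"
        using A B by (intro exI[of _ "A \<inter> B"]) (simp add: beta_set_Int le_infI1 le_infI2)
    qed
  next
    case (UN K)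
    show ?case
    proof
      fix F assume "F \<in> \<Union>K"
      then obtain k where k: "k \<in> K" "F \<in> k" by (rule UnionE)
      from UN.IH[OF k(1), THEN bspec, OF k(2)] obtain A where "A \<subseteq> S" "F \<in> beta_set A" "beta_set A \<subseteq> k"
        by auto
      then show "\<exists>A\<subseteq>S. F \<in> beta_set A \<and> beta_set A \<subseteq> \<Union>K"
        using Sup_upper2[OF k(1), of "beta_set A"] by blast
    qed
  next
    case (Basis s)
    then obtain A where "s = beta_set A" "A \<subseteq> S" by auto
    then show ?case by (intro ballI exI[of _ A]) simp
  qed
next
  assume U: "\<forall>F\<in>U. \<exists>A\<subseteq>S. F \<in> beta_set A \<and> beta_set A \<subseteq> U"
  have "\<forall>F\<in>U. \<exists>T. openin (beta S) T \<and> F \<in> T \<and> T \<subseteq> U"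
  proof
    fix F assume "F \<in> U"
    from bspec[OF U this] obtain A where "A \<subseteq> S" "F \<in> beta_set A" "beta_set A \<subseteq> U" by auto
    then show "\<exists>T. openin (beta S) T \<and> F \<in> T \<and> T \<subseteq> U"
      by (intro exI[of _ "beta_set A"]) (simp add: openin_beta_set)
  qed
  then show "openin (beta S) U" by (subst openin_subopen)
qed

lemma openin_betaE:
  assumes "openin (beta S) U" "F \<in> U"
  obtains A where "A \<subseteq> S" "F \<in> beta_set A" "beta_set A \<subseteq> U"
proof -
  have "\<exists>A\<subseteq>S. F \<in> beta_set A \<and> beta_set A \<subseteq> U"
    using assms(1)[unfolded openin_beta] assms(2) by (rule bspec)
  then show thesis using that by blast
qed

lemma closedin_beta_set:
  assumes "A \<subseteq> S"
  shows "closedin (beta S) (beta_set A)"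
  unfolding closedin_def topspace_beta
  using openin_beta_set[of "S - A" S] beta_set_mono[OF assms] by (simp add: beta_set_Diff)

lemma Hausdorff_beta: "Hausdorff_space (beta S)"
  unfolding Hausdorff_space_def
proof (intro allI impI)
  fix F G assume FG: "F \<in> topspace (beta S) \<and> G \<in> topspace (beta S) \<and> F \<noteq> G"
  then obtain A where "A \<subseteq> S" "F \<in> beta_set A" "G \<notin> beta_set A"
    using beta_set_eq_iff by (metis topspace_beta)
  moreover have "openin (beta S) (beta_set S - beta_set A)"
    using openin_beta_set[of "S - A" S] by (simp add: beta_set_Diff)
  ultimately show "\<exists>U V. openin (beta S) U \<and> openin (beta S) V \<and> F \<in> U \<and> G \<in> V \<and> disjnt U V"
    by (intro exI[of _ "beta_set A"] exI[of _ "beta_set S - beta_set A"])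
      (use FG in \<open>auto simp: openin_beta_set disjnt_def\<close>)
qed

lemma compact_beta: "compact_space (beta S)"
  unfolding compact_space_alt
proof (intro allI impI, rule ccontr)
  fix \<U> assume U: "(\<forall>U\<in>\<U>. openin (beta S) U) \<and> topspace (beta S) \<subseteq> \<Union>\<U>"
    and no: "\<nexists>\<F>. finite \<F> \<and> \<F> \<subseteq> \<U> \<and> topspace (beta S) \<subseteq> \<Union>\<F>"
  let ?C = "{A. A \<subseteq> S \<and> (\<exists>U\<in>\<U>. beta_set A \<subseteq> U)}"
  let ?B = "(\<lambda>\<A>. principal (S - \<Union>\<A>)) ` {\<A>. finite \<A> \<and> \<A> \<subseteq> ?C}"
  have ev: "eventually P (Inf ?B) \<longleftrightarrow> (\<exists>b\<in>?B. eventually P b)" for P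
  proof (rule eventually_Inf_base)
    show "?B \<noteq> {}" by blast
    fix F G assume "F \<in> ?B" "G \<in> ?B"
    then obtain \<A> \<B> where 1: "F = principal (S - \<Union>\<A>)" "finite \<A>" "\<A> \<subseteq> ?C" 
      and 2: "G = principal (S - \<Union>\<B>)" "finite \<B>" "\<B> \<subseteq> ?C" by auto
    have "principal (S - \<Union>(\<A> \<union> \<B>)) \<in> ?B" by (rule imageI) (use 1 2 in auto)
    then show "\<exists>x\<in>?B. x \<le> inf F G" using 1(1) 2(1)
      by (intro bexI[of _ "principal (S - \<Union>(\<A> \<union> \<B>))"]) auto
  qed
  have "Inf ?B \<noteq> bot"
  proof
    assume "Inf ?B = bot"
    then have "eventually (\<lambda>x. False) (Inf ?B)" by simp
    then have "\<exists>b\<in>?B. eventually (\<lambda>x. False) b" by (simp only: ev)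
    then obtain b where b: "b \<in> ?B" "eventually (\<lambda>x. False) b" by (rule bexE)
    from b(1) obtain \<A> where A: "finite \<A>" "\<A> \<subseteq> ?C" and "b = principal (S - \<Union>\<A>)"
      by (elim imageE CollectE conjE)
    with b(2) have "eventually (\<lambda>x. False) (principal (S - \<Union>\<A>))" by (simp only:)
    then have AS: "S \<subseteq> \<Union>\<A>" unfolding eventually_principal by blast
    from A(2) have "\<forall>A\<in>\<A>. \<exists>U. U \<in> \<U> \<and> beta_set A \<subseteq> U" by blast
    from bchoice[OF this] obtain u where u: "\<And>A. A \<in> \<A> \<Longrightarrow> u A \<in> \<U> \<and> beta_set A \<subseteq> u A" by auto
    have "beta_set S \<subseteq> (\<Union>A\<in>\<A>. beta_set A)"
      using beta_set_mono[OF AS] beta_set_UN[OF A(1), of "\<lambda>A. A"] by simp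
    also have "\<dots> \<subseteq> \<Union>(u ` \<A>)" using u by blast
    finally have "finite (u ` \<A>) \<and> u ` \<A> \<subseteq> \<U> \<and> topspace (beta S) \<subseteq> \<Union>(u ` \<A>)" using A(1) u by auto
    with no show False by blast
  qed
  then obtain F where F: "F \<le> Inf ?B" "is_ultrafilter F" using ultra_extends by blast
  have out: "eventually (\<lambda>x. x \<in> S - \<Union>\<A>) F" if "finite \<A>" "\<A> \<subseteq> ?C" for \<A>
  proof -
    have "principal (S - \<Union>\<A>) \<in> ?B" using that by (intro imageI) auto
    then have "F \<le> principal (S - \<Union>\<A>)" using F(1) by (meson Inf_lower order_trans)
    then show ?thesis by (simp add: le_principal)
  qed
  have "F \<in> topspace (beta S)" using out[of "{}"] F(2) by (simp add: beta_set_def)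
  then obtain U where "U \<in> \<U>" "F \<in> U" using U by auto
  then have oU: "openin (beta S) U" using U by blast
  obtain A where A: "A \<subseteq> S" "F \<in> beta_set A" "beta_set A \<subseteq> U"
    by (rule openin_betaE[OF oU \<open>F \<in> U\<close>])
  have "eventually (\<lambda>x. x \<in> S - A) F" using out[of "{A}"] A \<open>U \<in> \<U>\<close> by auto
  then have "F \<in> beta_set (S - A)" using F(2) by (simp add: beta_set_def)
  then show False using A(2) by (simp add: beta_set_Diff)
qed

lemma beta_set_nonempty: "F \<in> beta_set A \<Longrightarrow> \<exists>x. x \<in> A"
  using eventually_happens'[of F "\<lambda>x. x \<in> A"] by (simp add: beta_set_def is_ultrafilter_def)

lemma beta_closure:
  assumes "E \<subseteq> S"
  shows "beta S closure_of (beta_point ` E) = beta_set E"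
proof
  show "beta S closure_of (beta_point ` E) \<subseteq> beta_set E"
    by (rule closure_of_minimal) (auto simp: closedin_beta_set assms)
  show "beta_set E \<subseteq> beta S closure_of (beta_point ` E)"
  proof
    fix F assume F: "F \<in> beta_set E"
    have "\<exists>y\<in>beta_point ` E. y \<in> U" if oU: "openin (beta S) U" and FU: "F \<in> U" for U
    proof -
      obtain A where A: "F \<in> beta_set A" "beta_set A \<subseteq> U" by (rule openin_betaE[OF oU FU])
      then have "F \<in> beta_set (A \<inter> E)" using F by (simp add: beta_set_Int)
      then obtain x where "x \<in> A \<inter> E" using beta_set_nonempty by blast
      then have "beta_point x \<in> beta_set A" "beta_point x \<in> beta_point ` E" by auto
      then show ?thesis using A(2) by blast
    qed
    then show "F \<in> beta S closure_of (beta_point ` E)"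
      using F beta_set_mono[OF assms] by (auto simp: in_closure_of)
  qed
qed

lemma beta_point_eq_iff [simp]: "beta_point x = beta_point y \<longleftrightarrow> x = y"
proof
  assume "beta_point x = beta_point y"
  moreover have "beta_point x \<in> beta_set {x}" by simp
  ultimately have "beta_point y \<in> beta_set {x}" by simp
  then show "x = y" by simp
qed simp

lemma beta_set_singleton: "beta_set {x} = {beta_point x}"
proof -
  have "F = beta_point x" if "F \<in> beta_set {x}" for F
  proof -
    have "F \<noteq> bot" "F \<le> beta_point x" using that
      by (auto simp: beta_set_def is_ultrafilter_def beta_point_def le_principal)
    moreover have "is_ultrafilter (beta_point x)" by (rule beta_setD[of _ "{x}"]) simp
    ultimately show ?thesis using ultra_max[of "beta_point x" F] by simp
  qed
  then show ?thesis by auto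
qed

theorem embedding_map_beta_point: "embedding_map (discrete_topology S) (beta S) beta_point"
proof (rule injective_open_imp_embedding_map)
  show "continuous_map (discrete_topology S) (beta S) beta_point"
    by (simp add: Pi_iff)
  show "inj_on beta_point (topspace (discrete_topology S))"
    by (simp add: inj_on_def)
  show "open_map (discrete_topology S) (beta S) beta_point"
    unfolding open_map_def
  proof (intro allI impI)
    fix U assume U: "openin (discrete_topology S) U"
    have "\<exists>A\<subseteq>S. F \<in> beta_set A \<and> beta_set A \<subseteq> beta_point ` U" if "F \<in> beta_point ` U" for F
    proof -
      from that obtain x where "x \<in> U" "F = beta_point x" by blast
      then show ?thesis using U by (intro exI[of _ "{x}"]) (simp add: beta_set_singleton subset_iff)
    qed
    then show "openin (beta S) (beta_point ` U)"
      unfolding openin_beta by blast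
  qed
qed

lemma ultra_limit:
  assumes Y: "compact_space Y" and f: "f \<in> S \<rightarrow> topspace Y" and F: "F \<in> beta_set S"
  shows "\<exists>l. limitin Y f l F"
proof (rule ccontr)
  assume "\<nexists>l. limitin Y f l F"
  then have "\<forall>l\<in>topspace Y. \<exists>U. openin Y U \<and> l \<in> U \<and> \<not> eventually (\<lambda>x. f x \<in> U) F"
    by (auto simp: limitin_def)
  from bchoice[OF this] obtain U where U: "\<And>l. l \<in> topspace Y \<Longrightarrow> openin Y (U l) \<and> l \<in> U l \<and> \<not> eventually (\<lambda>x. f x \<in> U l) F"
    by auto
  have "\<exists>\<F>. finite \<F> \<and> \<F> \<subseteq> U ` topspace Y \<and> topspace Y \<subseteq> \<Union>\<F>"
    using Y unfolding compact_space_alt by (elim allE[of _ "U ` topspace Y"] impE) (use U in auto)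
  then obtain \<F> where \<F>: "finite \<F>" "\<F> \<subseteq> U ` topspace Y" "topspace Y \<subseteq> \<Union>\<F>" by auto
  have "eventually (\<lambda>x. \<forall>V\<in>\<F>. f x \<notin> V) F"
    using \<F> U F by (intro eventually_ball_finite) (auto simp: beta_set_def ultra_not)
  moreover have "eventually (\<lambda>x. x \<in> S) F" using F by (simp add: beta_set_def)
  ultimately have "eventually (\<lambda>x. False) F"
    by eventually_elim (use f \<F>(3) in blast)
  then show False using F by (auto simp: beta_set_def is_ultrafilter_def)
qed

lemma continuous_extension_ex1:
  assumes "Hausdorff_space Y" "topspace T \<subseteq> T closure_of (i ` D)" 
    and "continuous_map T Y g" and g: "\<And>p. p \<in> D \<Longrightarrow> i p \<in> topspace T \<and> g (i p) = f p"
  shows "\<exists>!g. g \<in> extensional (topspace T) \<and> continuous_map T Y g \<and> (\<forall>p\<in>D. g (i p) = f p)"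
proof (rule ex1I[of _ "restrict g (topspace T)"])
  show "restrict g (topspace T) \<in> extensional (topspace T) \<and>
    continuous_map T Y (restrict g (topspace T)) \<and> (\<forall>p\<in>D. restrict g (topspace T) (i p) = f p)"
    using assms by (auto intro: continuous_map_eq)
  fix h assume h: "h \<in> extensional (topspace T) \<and> continuous_map T Y h \<and> (\<forall>p\<in>D. h (i p) = f p)"
  have "h x = g x" if "x \<in> topspace T" for x
    by (rule forall_in_closure_of_eq[of x T "i ` D" Y]) (use assms that h in auto)
  then show "h = restrict g (topspace T)" using h by (auto intro: extensionalityI[of _ "topspace T"])
qed

lemma continuous_extension_eq:
  assumes "Hausdorff_space Y" "topspace T \<subseteq> T closure_of (i ` D)" 
    and "continuous_map T Y g" and g: "\<And>p. p \<in> D \<Longrightarrow> i p \<in> topspace T \<and> g (i p) = f p"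
    and x: "x \<in> topspace T"
  shows "continuous_extension T i D Y f x = g x"
proof -
  have "continuous_extension T i D Y f = restrict g (topspace T)"
    unfolding continuous_extension_def
    by (rule the1_equality[OF continuous_extension_ex1[OF assms(1-4)]])
       (use assms in \<open>auto intro: continuous_map_eq\<close>)
  with x show ?thesis by simp
qed

theorem beta_universal:
  assumes Y: "compact_space Y" "Hausdorff_space Y" and f: "f \<in> S \<rightarrow> topspace Y"
  shows "\<exists>!g. g \<in> extensional (topspace (beta S)) \<and> continuous_map (beta S) Y g \<and>
                (\<forall>p\<in>S. g (beta_point p) = f p)"
proof -
  define g where "g F = (SOME l. limitin Y f l F)" for F
  have g: "limitin Y f (g F) F" if "F \<in> beta_set S" for F
    unfolding g_def using ultra_limit[OF Y(1) f that] by (rule someI_ex)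
  have reg: "regular_space Y" using Y by (simp add: compact_Hausdorff_imp_regular_space)
  have "continuous_map (beta S) Y g"
    unfolding continuous_map_def topspace_beta openin_beta
  proof (intro conjI allI impI ballI)
    show "g \<in> beta_set S \<rightarrow> topspace Y" using g by (auto dest!: limitin_topspace)
    fix U F assume U: "openin Y U" and F: "F \<in> {x \<in> beta_set S. g x \<in> U}"
    have nb: "neighbourhood_base_of (closedin Y) Y" using reg by (simp add: neighbourhood_base_of_closedin)
    have "openin Y U \<and> g F \<in> U" using U F by simp
    then obtain V C where VC: "openin Y V" "closedin Y C" "g F \<in> V" "V \<subseteq> C" "C \<subseteq> U"
      using nb[unfolded neighbourhood_base_of, rule_format, of U "g F"] by blast
    let ?A = "{x\<in>S. f x \<in> V}"
    have "F \<in> beta_set ?A" using F g[of F] VC by (auto simp: beta_set_def limitin_def eventually_conj_iff)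
    moreover have "g G \<in> U" if G: "G \<in> beta_set ?A" for G
    proof (rule ccontr)
      assume "g G \<notin> U"
      have GS: "G \<in> beta_set S" using G beta_set_mono[of ?A S] by auto
      have "g G \<in> topspace Y - C" using limitin_topspace[OF g[OF GS]] VC(5) \<open>g G \<notin> U\<close> by blast
      then have "eventually (\<lambda>x. f x \<in> topspace Y - C) G"
        by (rule limitinD[OF g[OF GS] openin_diff[OF openin_topspace VC(2)]])
      moreover have "eventually (\<lambda>x. x \<in> ?A) G" using G by (simp add: beta_set_def)
      ultimately have "eventually (\<lambda>x. False) G" by eventually_elim (use VC in auto)
      then show False using G by (auto simp: beta_set_def is_ultrafilter_def)
    qed
    ultimately show "\<exists>A\<subseteq>S. F \<in> beta_set A \<and> beta_set A \<subseteq> {x \<in> beta_set S. g x \<in> U}"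
      using beta_set_mono[of ?A S] by (intro exI[of _ ?A]) auto
  qed
  moreover have "g (beta_point p) = f p" if "p \<in> S" for p
  proof (rule limitin_Hausdorff_unique[OF g _ _ Y(2)])
    show "beta_point p \<in> beta_set S" using that by simp
    show "\<not> trivial_limit (beta_point p)" by simp
    show "limitin Y f (f p) (beta_point p)" using that f by (auto simp: limitin_def)
  qed
  ultimately show ?thesis
    by (intro continuous_extension_ex1) (simp_all add: Y beta_closure)
qed


section \<open>Topological groupoids\<close>

record 'g topological_groupoid =
  arrows :: "'g topology"
  units :: "'g set"
  src :: "'g \<Rightarrow> 'g"
  rng :: "'g \<Rightarrow> 'g"
  mul :: "'g \<Rightarrow> 'g \<Rightarrow> 'g"
  ginv :: "'g \<Rightarrow> 'g"

definition subgroupoid :: "('g, 'z) topological_groupoid_scheme \<Rightarrow> 'g set \<Rightarrow> bool" where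
  "subgroupoid G H \<longleftrightarrow>
     H \<subseteq> topspace (arrows G) \<and>
     (\<forall>g\<in>H. src G g \<in> H \<and> rng G g \<in> H \<and> ginv G g \<in> H) \<and>
     (\<forall>g\<in>H. \<forall>h\<in>H. src G g = rng G h \<longrightarrow> mul G g h \<in> H)"

definition precompact_in :: "'a topology \<Rightarrow> 'a set \<Rightarrow> bool" where
  "precompact_in T A \<longleftrightarrow> A \<subseteq> topspace T \<and> compactin T (T closure_of A)"

definition dad_cover ::
    "('g, 'z) topological_groupoid_scheme \<Rightarrow> 'g set \<Rightarrow> nat \<Rightarrow> (nat \<Rightarrow> 'g set) \<Rightarrow> bool" where
  "dad_cover G K m U \<longleftrightarrow>
     (\<forall>i\<le>m. openin (subtopology (arrows G) (units G)) (U i)) \<and>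
     (\<Union>i\<le>m. U i) = units G \<and>
     (\<forall>i\<le>m. \<exists>H. subgroupoid G H \<and> precompact_in (arrows G) H \<and>
        {g \<in> K. src G g \<in> U i \<and> rng G g \<in> U i} \<subseteq> H)"

text \<open>
  The value is \<open>\<infinity>\<close> when no \<open>m\<close> admits a cover; an infinite value is never bounded by a real-valued
  function in \<open>growth_le\<close> below.
\<close>

definition dad :: "('g, 'z) topological_groupoid_scheme \<Rightarrow> ('g \<Rightarrow> real) \<Rightarrow> real \<Rightarrow> enat" where
  "dad G len R =
     (INF m\<in>{m. \<exists>U. dad_cover G {z \<in> topspace (arrows G). len z < R} m U}. enat m)"

definition growth_le :: "(real \<Rightarrow> ereal) \<Rightarrow> (real \<Rightarrow> ereal) \<Rightarrow> bool" where
  "growth_le f g \<longleftrightarrow>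
     (\<exists>k::nat. \<forall>x>real k. f x \<le> ereal (real k) * g (real k * x + real k) + ereal (real k))"

definition subexponential_growth :: "(real \<Rightarrow> real) \<Rightarrow> bool" where
  "subexponential_growth f \<longleftrightarrow>
     (\<forall>x\<ge>0. 0 \<le> f x) \<and> mono_on {0..} f \<and>
     (\<forall>b>1. ((\<lambda>t. f t / b powr t) \<longlongrightarrow> 0) at_top)"

definition subexponential_dad_growth ::
    "('g, 'z) topological_groupoid_scheme \<Rightarrow> ('g \<Rightarrow> real) \<Rightarrow> bool" where
  "subexponential_dad_growth G len \<longleftrightarrow>
     (\<exists>f. subexponential_growth f \<and>
        growth_le (\<lambda>R. ereal_of_enat (dad G len R)) (\<lambda>R. ereal (f R)))"

definition src_fibre :: "('g, 'z) topological_groupoid_scheme \<Rightarrow> 'g \<Rightarrow> 'g set" where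
  "src_fibre G x = {g \<in> topspace (arrows G). src G g = x}"

text \<open>
  The fibres of an etale groupoid are closed and discrete, so a compactly supported \<open>\<mu>\<close> has finite
  support on each of them and the first condition does not hide a convergence requirement. The
  sums in the other two conditions then converge as well. This matters because
  \<open>infsum\<close> is \<open>0\<close> by convention on families that are not summable.
\<close>

definition amenable_groupoid :: "('g, 'z) topological_groupoid_scheme \<Rightarrow> bool" where
  "amenable_groupoid G \<longleftrightarrow>
     (\<forall>K \<epsilon>. compactin (arrows G) K \<and> 0 < \<epsilon> \<longrightarrow>
       (\<exists>\<mu> :: 'g \<Rightarrow> real.
          continuous_map (arrows G) (top_of_set {0..1}) \<mu> \<and>
          compactin (arrows G) (arrows G closure_of {g \<in> topspace (arrows G). \<mu> g \<noteq> 0}) \<and>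
          (\<forall>x\<in>units G. \<mu> summable_on src_fibre G x \<and> (\<Sum>\<^sub>\<infinity>g\<in>src_fibre G x. \<mu> g) \<le> 1) \<and>
          (\<forall>k\<in>K. \<bar>1 - (\<Sum>\<^sub>\<infinity>g\<in>src_fibre G (rng G k). \<mu> g)\<bar> < \<epsilon>) \<and>
          (\<forall>k\<in>K. (\<Sum>\<^sub>\<infinity>g\<in>src_fibre G (rng G k). \<bar>\<mu> g - \<mu> (mul G g k)\<bar>) < \<epsilon>)))"


section \<open>The coarse groupoid of a metric space\<close>

definition bounded_geometry :: "'a set \<Rightarrow> ('a \<Rightarrow> 'a \<Rightarrow> real) \<Rightarrow> bool" where
  "bounded_geometry X d \<longleftrightarrow>
     (\<forall>r>0. \<exists>n::nat. \<forall>x\<in>X. finite (Metric_space.mball X d x r) \<and>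
        card (Metric_space.mball X d x r) \<le> n)"

definition entourage :: "'a set \<Rightarrow> ('a \<Rightarrow> 'a \<Rightarrow> real) \<Rightarrow> real \<Rightarrow> ('a \<times> 'a) set" where
  "entourage X d R = {(x, y). x \<in> X \<and> y \<in> X \<and> d x y \<le> R}"

definition entourage_closure ::
    "'a set \<Rightarrow> ('a \<Rightarrow> 'a \<Rightarrow> real) \<Rightarrow> real \<Rightarrow> ('a \<times> 'a) filter set" where
  "entourage_closure X d R = beta (X \<times> X) closure_of (beta_point ` entourage X d R)"

definition coarse_arrows :: "'a set \<Rightarrow> ('a \<Rightarrow> 'a \<Rightarrow> real) \<Rightarrow> ('a \<times> 'a) filter topology" where
  "coarse_arrows X d =
     topology (\<lambda>U. U \<subseteq> (\<Union>R\<in>{0..}. entourage_closure X d R) \<and>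
       (\<forall>R\<ge>0. openin (subtopology (beta (X \<times> X)) (entourage_closure X d R))
                 (U \<inter> entourage_closure X d R)))"

text \<open>
  A point \<open>x\<close> of \<open>X\<close> is identified with the unit \<open>(x, x)\<close>, so source and range take values in the
  arrow space, extending \<open>(x, y) \<mapsto> (y, y)\<close> and \<open>(x, y) \<mapsto> (x, x)\<close>.
\<close>

definition coarse_src ::
    "'a set \<Rightarrow> ('a \<Rightarrow> 'a \<Rightarrow> real) \<Rightarrow> ('a \<times> 'a) filter \<Rightarrow> ('a \<times> 'a) filter" where
  "coarse_src X d = continuous_extension (coarse_arrows X d) beta_point (X \<times> X)
     (coarse_arrows X d) (\<lambda>(x, y). beta_point (y, y))"

definition coarse_rng ::
    "'a set \<Rightarrow> ('a \<Rightarrow> 'a \<Rightarrow> real) \<Rightarrow> ('a \<times> 'a) filter \<Rightarrow> ('a \<times> 'a) filter" where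
  "coarse_rng X d = continuous_extension (coarse_arrows X d) beta_point (X \<times> X)
     (coarse_arrows X d) (\<lambda>(x, y). beta_point (x, x))"

definition coarse_inv ::
    "'a set \<Rightarrow> ('a \<Rightarrow> 'a \<Rightarrow> real) \<Rightarrow> ('a \<times> 'a) filter \<Rightarrow> ('a \<times> 'a) filter" where
  "coarse_inv X d = continuous_extension (coarse_arrows X d) beta_point (X \<times> X)
     (coarse_arrows X d) (\<lambda>(x, y). beta_point (y, x))"

definition coarse_composable ::
    "'a set \<Rightarrow> ('a \<Rightarrow> 'a \<Rightarrow> real) \<Rightarrow> (('a \<times> 'a) filter \<times> ('a \<times> 'a) filter) topology" where
  "coarse_composable X d =
     subtopology (prod_topology (coarse_arrows X d) (coarse_arrows X d))
       {(g, h). coarse_src X d g = coarse_rng X d h}"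

definition coarse_mul :: "'a set \<Rightarrow> ('a \<Rightarrow> 'a \<Rightarrow> real) \<Rightarrow>
    ('a \<times> 'a) filter \<Rightarrow> ('a \<times> 'a) filter \<Rightarrow> ('a \<times> 'a) filter" where
  "coarse_mul X d g h = continuous_extension (coarse_composable X d)
     (\<lambda>(x, y, z). (beta_point (x, y), beta_point (y, z))) (X \<times> X \<times> X)
     (coarse_arrows X d) (\<lambda>(x, y, z). beta_point (x, z)) (g, h)"

definition coarse_groupoid ::
    "'a set \<Rightarrow> ('a \<Rightarrow> 'a \<Rightarrow> real) \<Rightarrow> ('a \<times> 'a) filter topological_groupoid" where
  "coarse_groupoid X d =
     \<lparr>arrows = coarse_arrows X d, units = entourage_closure X d 0,
      src = coarse_src X d, rng = coarse_rng X d, mul = coarse_mul X d, ginv = coarse_inv X d\<rparr>"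

text \<open>
  The type \<open>ennreal\<close> with its euclidean topology is \<open>[0, \<infinity>]\<close>; the extension is finite on the
  coarse groupoid.
\<close>

definition coarse_length :: "'a set \<Rightarrow> ('a \<Rightarrow> 'a \<Rightarrow> real) \<Rightarrow> ('a \<times> 'a) filter \<Rightarrow> real" where
  "coarse_length X d z = enn2real
     (continuous_extension (beta (X \<times> X)) beta_point (X \<times> X) euclidean (\<lambda>(x, y). ennreal (d x y)) z)"


subsection \<open>The structure maps are well defined\<close>

text \<open>
  The facts below show that every use of \<open>continuous_extension\<close> above is justified: the extensions
  exist and are unique, and for the structure maps they are given by image filters.
\<close>

lemma entourage_subset: "entourage X d R \<subseteq> X \<times> X"
  by (auto simp: entourage_def)

lemma entourage_closure_eq: "entourage_closure X d R = beta_set (entourage X d R)"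
  unfolding entourage_closure_def by (rule beta_closure[OF entourage_subset])

definition coarse_set :: "'a set \<Rightarrow> ('a \<Rightarrow> 'a \<Rightarrow> real) \<Rightarrow> ('a \<times> 'a) filter set" where
  "coarse_set X d = (\<Union>R\<in>{0..}. beta_set (entourage X d R))"

lemma coarse_setI: "0 \<le> R \<Longrightarrow> z \<in> beta_set (entourage X d R) \<Longrightarrow> z \<in> coarse_set X d"
  by (auto simp: coarse_set_def)

lemma coarse_setE:
  assumes "z \<in> coarse_set X d"
  obtains R where "0 \<le> R" "z \<in> beta_set (entourage X d R)"
  using assms unfolding coarse_set_def by (elim UN_E) simp

lemma coarse_set_subset: "coarse_set X d \<subseteq> beta_set (X \<times> X)"
  unfolding coarse_set_def by (rule UN_least) (rule beta_set_mono[OF entourage_subset])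

lemma openin_coarse_set: "openin (beta (X \<times> X)) (coarse_set X d)"
  unfolding coarse_set_def by (rule openin_Union) (auto intro: openin_beta_set[OF entourage_subset])

theorem coarse_arrows_eq: "coarse_arrows X d = subtopology (beta (X \<times> X)) (coarse_set X d)"
proof -
  let ?T = "subtopology (beta (X \<times> X)) (coarse_set X d)"
  have "(U \<subseteq> (\<Union>R\<in>{0..}. entourage_closure X d R) \<and>
       (\<forall>R\<ge>0. openin (subtopology (beta (X \<times> X)) (entourage_closure X d R))
                 (U \<inter> entourage_closure X d R))) \<longleftrightarrow> openin ?T U" (is "?L \<longleftrightarrow> ?R") for U
  proof -
    have op: "openin (beta (X \<times> X)) (beta_set (entourage X d R))" for R
      by (rule openin_beta_set[OF entourage_subset])
    have L: "?L \<longleftrightarrow> U \<subseteq> coarse_set X d \<and>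
        (\<forall>R\<ge>0. openin (beta (X \<times> X)) (U \<inter> beta_set (entourage X d R)))"
      unfolding entourage_closure_eq coarse_set_def by (simp add: openin_open_subtopology op)
    have R: "?R \<longleftrightarrow> openin (beta (X \<times> X)) U \<and> U \<subseteq> coarse_set X d"
      by (rule openin_open_subtopology[OF openin_coarse_set])
    have "openin (beta (X \<times> X)) U"
      if "U \<subseteq> coarse_set X d" "\<forall>R\<ge>0. openin (beta (X \<times> X)) (U \<inter> beta_set (entourage X d R))"
    proof -
      have "U = (\<Union>R\<in>{0..}. U \<inter> beta_set (entourage X d R))"
        using that(1) by (auto simp: coarse_set_def)
      moreover have "openin (beta (X \<times> X)) (\<Union>R\<in>{0..}. U \<inter> beta_set (entourage X d R))"
        by (rule openin_Union) (use that(2) in auto)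
      ultimately show ?thesis by simp
    qed
    then show ?thesis unfolding L R using op by (auto intro: openin_Int)
  qed
  then have "coarse_arrows X d = topology (openin ?T)"
    unfolding coarse_arrows_def by presburger
  then show ?thesis by (simp add: openin_inverse)
qed

lemma topspace_coarse_arrows [simp]: "topspace (coarse_arrows X d) = coarse_set X d"
  unfolding coarse_arrows_eq topspace_subtopology topspace_beta
  using coarse_set_subset by blast

lemma openin_coarse_arrows:
  "openin (coarse_arrows X d) U \<longleftrightarrow> openin (beta (X \<times> X)) U \<and> U \<subseteq> coarse_set X d"
  unfolding coarse_arrows_eq by (rule openin_open_subtopology[OF openin_coarse_set])

lemma openin_coarse_beta_set:
  assumes "A \<subseteq> entourage X d R" "0 \<le> R"
  shows "openin (coarse_arrows X d) (beta_set A)"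
  unfolding openin_coarse_arrows
proof
  show "openin (beta (X \<times> X)) (beta_set A)"
    by (rule openin_beta_set[OF order_trans[OF assms(1) entourage_subset]])
  show "beta_set A \<subseteq> coarse_set X d"
    using beta_set_mono[OF assms(1)] coarse_setI[OF assms(2)] by blast
qed

theorem Hausdorff_coarse_arrows: "Hausdorff_space (coarse_arrows X d)"
  unfolding coarse_arrows_eq by (rule Hausdorff_space_subtopology[OF Hausdorff_beta])

theorem entourage_closure_compact_open:
  assumes "0 \<le> R"
  shows "compactin (coarse_arrows X d) (entourage_closure X d R)"
    and "openin (coarse_arrows X d) (entourage_closure X d R)"
proof -
  have "compactin (beta (X \<times> X)) (beta_set (entourage X d R))"
    by (rule closedin_compact_space[OF compact_beta closedin_beta_set[OF entourage_subset]])
  moreover have "beta_set (entourage X d R) \<subseteq> coarse_set X d"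
    using coarse_setI[OF assms] by blast
  ultimately show "compactin (coarse_arrows X d) (entourage_closure X d R)"
    unfolding coarse_arrows_eq entourage_closure_eq by (simp add: compactin_subtopology)
  show "openin (coarse_arrows X d) (entourage_closure X d R)"
    unfolding entourage_closure_eq by (rule openin_coarse_beta_set[OF order_refl assms])
qed

lemma filtermap_beta_set:
  assumes "F \<in> beta_set A" "\<And>x. x \<in> A \<Longrightarrow> f x \<in> B"
  shows "filtermap f F \<in> beta_set B"
proof -
  have "eventually (\<lambda>x. f x \<in> B) F"
    by (rule eventually_mono[of "\<lambda>x. x \<in> A"]) (use assms in \<open>simp_all add: beta_set_def\<close>)
  then show ?thesis
    using assms(1) by (simp add: beta_set_def is_ultrafilter_def eventually_filtermap filtermap_bot_iff)
qed

lemma filtermap_beta_point [simp]: "filtermap f (beta_point p) = beta_point (f p)"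
  by (simp add: beta_point_def)

lemma beta_set_restrict:
  assumes "F \<in> beta_set A" "eventually P F"
  shows "F \<in> beta_set {x \<in> A. P x}"
  using assms by (simp add: beta_set_def eventually_conj_iff)

lemma beta_set_restrictD: "F \<in> beta_set {x \<in> A. P x} \<Longrightarrow> F \<in> beta_set A \<and> eventually P F"
  by (simp add: beta_set_def eventually_conj_iff)

lemma continuous_map_coarse_filtermap:
  assumes "\<And>R p. 0 \<le> R \<Longrightarrow> p \<in> entourage X d R \<Longrightarrow> f p \<in> entourage X d R"
  shows "continuous_map (coarse_arrows X d) (coarse_arrows X d) (filtermap f)"
  unfolding continuous_map_def topspace_coarse_arrows
proof (intro conjI allI impI)
  have mem: "filtermap f z \<in> coarse_set X d" if z: "z \<in> coarse_set X d" for z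
  proof -
    obtain R where R: "0 \<le> R" "z \<in> beta_set (entourage X d R)" by (rule coarse_setE[OF z])
    show ?thesis
      by (rule coarse_setI[OF R(1)], rule filtermap_beta_set[OF R(2)], rule assms[OF R(1)])
  qed
  then show "filtermap f \<in> coarse_set X d \<rightarrow> coarse_set X d" by simp
  fix U assume U: "openin (coarse_arrows X d) U"
  show "openin (coarse_arrows X d) {z \<in> coarse_set X d. filtermap f z \<in> U}"
  proof (subst openin_subopen, rule ballI)
    fix z assume z: "z \<in> {z \<in> coarse_set X d. filtermap f z \<in> U}"
    then obtain R where R: "0 \<le> R" "z \<in> beta_set (entourage X d R)" by (auto elim: coarse_setE)
    have oU: "openin (beta (X \<times> X)) U" using U by (simp add: openin_coarse_arrows)
    have "filtermap f z \<in> U" using z by simp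
    then obtain A where A: "filtermap f z \<in> beta_set A" "beta_set A \<subseteq> U"
      by (rule openin_betaE[OF oU])
    let ?B = "{p \<in> entourage X d R. f p \<in> A}"
    have "openin (coarse_arrows X d) (beta_set ?B)"
      by (rule openin_coarse_beta_set[OF _ R(1)]) simp
    moreover have "z \<in> beta_set ?B"
      using A(1) by (intro beta_set_restrict[OF R(2)]) (simp add: beta_set_def eventually_filtermap)
    moreover have "beta_set ?B \<subseteq> {z \<in> coarse_set X d. filtermap f z \<in> U}"
    proof
      fix w assume w: "w \<in> beta_set ?B"
      have "filtermap f w \<in> beta_set A" by (rule filtermap_beta_set[OF w]) simp
      moreover have "w \<in> coarse_set X d" using beta_set_restrictD[OF w] by (intro coarse_setI[OF R(1)]) simp
      ultimately show "w \<in> {z \<in> coarse_set X d. filtermap f z \<in> U}" using A(2) by blast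
    qed
    ultimately show "\<exists>T. openin (coarse_arrows X d) T \<and> z \<in> T \<and>
        T \<subseteq> {z \<in> coarse_set X d. filtermap f z \<in> U}" by (intro exI[of _ "beta_set ?B"] conjI)
  qed
qed

definition coarse_comp ::
    "('a \<times> 'a) filter \<Rightarrow> ('a \<times> 'a) filter \<Rightarrow> ('a \<times> 'a) filter" where
  "coarse_comp g h = filtermap (\<lambda>(p, q). (fst p, snd q))
     (inf (g \<times>\<^sub>F h) (principal {(p, q). snd p = fst q}))"

lemma eventually_coarse_comp:
  "eventually P (coarse_comp g h) \<longleftrightarrow>
     (\<exists>A B. eventually A g \<and> eventually B h \<and> (\<forall>x y z. A (x, y) \<longrightarrow> B (y, z) \<longrightarrow> P (x, z)))"
  unfolding coarse_comp_def eventually_filtermap eventually_inf_principal eventually_prod_filter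
  by (simp add: split_paired_all)

context
  fixes X :: "'a set" and d :: "'a \<Rightarrow> 'a \<Rightarrow> real"
  assumes metric: "Metric_space X d"
begin

lemma entourageD_nonneg: "(x, y) \<in> entourage X d R \<Longrightarrow> 0 \<le> R"
  using Metric_space.nonneg[OF metric, of x y] by (simp add: entourage_def)

lemma beta_point_in_coarse: "x \<in> X \<Longrightarrow> y \<in> X \<Longrightarrow> beta_point (x, y) \<in> coarse_set X d"
  using Metric_space.nonneg[OF metric, of x y]
  by (intro coarse_setI[of "d x y"]) (simp_all add: entourage_def)

lemma coarse_dense: "coarse_set X d \<subseteq> coarse_arrows X d closure_of (beta_point ` (X \<times> X))"
proof
  fix z assume z: "z \<in> coarse_set X d"
  have "\<exists>y\<in>beta_point ` (X \<times> X). y \<in> U" if U: "openin (coarse_arrows X d) U" and zU: "z \<in> U" for U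
  proof -
    have oU: "openin (beta (X \<times> X)) U" using U by (simp add: openin_coarse_arrows)
    obtain A where A: "A \<subseteq> X \<times> X" "z \<in> beta_set A" "beta_set A \<subseteq> U"
      by (rule openin_betaE[OF oU zU])
    obtain p where p: "p \<in> A" using beta_set_nonempty[OF A(2)] by (rule exE)
    then have "beta_point p \<in> U" using A(3) beta_point_in_iff[of p A] by blast
    then show ?thesis using p A(1) by blast
  qed
  with z show "z \<in> coarse_arrows X d closure_of (beta_point ` (X \<times> X))"
    by (simp add: in_closure_of)
qed

theorem coarse_extension_filtermap:
  assumes "\<And>R p. 0 \<le> R \<Longrightarrow> p \<in> entourage X d R \<Longrightarrow> f p \<in> entourage X d R"
    and z: "z \<in> coarse_set X d"
  shows "continuous_extension (coarse_arrows X d) beta_point (X \<times> X) (coarse_arrows X d)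
           (\<lambda>p. beta_point (f p)) z = filtermap f z"
proof (rule continuous_extension_eq[OF Hausdorff_coarse_arrows])
  show "topspace (coarse_arrows X d) \<subseteq> coarse_arrows X d closure_of (beta_point ` (X \<times> X))"
    using coarse_dense by simp
  show "continuous_map (coarse_arrows X d) (coarse_arrows X d) (filtermap f)"
    by (rule continuous_map_coarse_filtermap[OF assms(1)])
  show "z \<in> topspace (coarse_arrows X d)" using z by simp
  fix p assume "p \<in> X \<times> X"
  then show "beta_point p \<in> topspace (coarse_arrows X d) \<and> filtermap f (beta_point p) = beta_point (f p)"
    using beta_point_in_coarse by auto
qed

lemma entourage_fst: "p \<in> entourage X d R \<Longrightarrow> (fst p, fst p) \<in> entourage X d R"
  using entourageD_nonneg[of "fst p" "snd p" R] Metric_space.zero[OF metric, of "fst p" "fst p"]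
  by (auto simp: entourage_def)

lemma entourage_snd: "p \<in> entourage X d R \<Longrightarrow> (snd p, snd p) \<in> entourage X d R"
  using entourageD_nonneg[of "fst p" "snd p" R] Metric_space.zero[OF metric, of "snd p" "snd p"]
  by (auto simp: entourage_def)

lemma entourage_swap: "p \<in> entourage X d R \<Longrightarrow> (snd p, fst p) \<in> entourage X d R"
  using Metric_space.commute[OF metric, of "fst p" "snd p"] by (auto simp: entourage_def)

theorem coarse_src_eq: "z \<in> coarse_set X d \<Longrightarrow> coarse_src X d z = filtermap (\<lambda>(x, y). (y, y)) z"
  unfolding coarse_src_def split_def by (rule coarse_extension_filtermap[OF entourage_snd])

theorem coarse_rng_eq: "z \<in> coarse_set X d \<Longrightarrow> coarse_rng X d z = filtermap (\<lambda>(x, y). (x, x)) z"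
  unfolding coarse_rng_def split_def by (rule coarse_extension_filtermap[OF entourage_fst])

theorem coarse_inv_eq: "z \<in> coarse_set X d \<Longrightarrow> coarse_inv X d z = filtermap (\<lambda>(x, y). (y, x)) z"
  unfolding coarse_inv_def split_def by (rule coarse_extension_filtermap[OF entourage_swap])

lemma composable_happens:
  assumes g: "g \<in> coarse_set X d" and h: "h \<in> coarse_set X d"
    and gh: "coarse_src X d g = coarse_rng X d h"
    and A: "eventually A g" and B: "eventually B h"
  shows "\<exists>x y z. A (x, y) \<and> B (y, z)"
proof -
  have "eventually (\<lambda>p. \<exists>x. A (x, fst p)) (coarse_src X d g)"
    unfolding coarse_src_eq[OF g] eventually_filtermap by (rule eventually_mono[OF A]) auto
  moreover have "eventually (\<lambda>p. \<exists>z. B (fst p, z)) (coarse_src X d g)"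
    unfolding gh coarse_rng_eq[OF h] eventually_filtermap by (rule eventually_mono[OF B]) auto
  ultimately have ev: "eventually (\<lambda>p. (\<exists>x. A (x, fst p)) \<and> (\<exists>z. B (fst p, z))) (coarse_src X d g)"
    by (rule eventually_conj)
  have "coarse_src X d g \<noteq> bot"
    using g by (auto simp: coarse_src_eq[OF g] filtermap_bot_iff beta_set_def is_ultrafilter_def elim: coarse_setE)
  from eventually_happens'[OF this ev] show ?thesis by auto
qed

lemma topspace_coarse_composable:
  "topspace (coarse_composable X d) =
     {(g, h). g \<in> coarse_set X d \<and> h \<in> coarse_set X d \<and> coarse_src X d g = coarse_rng X d h}"
  unfolding coarse_composable_def by auto

lemma composable_dense:
  "topspace (coarse_composable X d) \<subseteq> coarse_composable X d closure_of
     ((\<lambda>(x, y, z). (beta_point (x, y), beta_point (y, z))) ` (X \<times> X \<times> X))" (is "_ \<subseteq> _ closure_of ?P")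
proof
  fix gh assume gh: "gh \<in> topspace (coarse_composable X d)"
  obtain g h where gh_eq: "gh = (g, h)" by (rule prod.exhaust)
  with gh have g: "g \<in> coarse_set X d" and h: "h \<in> coarse_set X d"
    and c: "coarse_src X d g = coarse_rng X d h"
    by (simp_all add: topspace_coarse_composable)
  have "\<exists>p\<in>?P. p \<in> V" if V: "openin (coarse_composable X d) V" and "gh \<in> V" for V
  proof -
    obtain W where W: "openin (prod_topology (coarse_arrows X d) (coarse_arrows X d)) W"
      and VW: "V = W \<inter> {(g, h). coarse_src X d g = coarse_rng X d h}"
      using V unfolding coarse_composable_def openin_subtopology by auto
    have "(g, h) \<in> W" using \<open>gh \<in> V\<close> VW gh_eq by simp
    then obtain U1 U2 where U: "openin (coarse_arrows X d) U1" "openin (coarse_arrows X d) U2"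
      "g \<in> U1" "h \<in> U2" "U1 \<times> U2 \<subseteq> W"
      using W unfolding openin_prod_topology_alt by meson
    from U(1,2) have oU: "openin (beta (X \<times> X)) U1" "openin (beta (X \<times> X)) U2"
      by (simp_all add: openin_coarse_arrows)
    obtain A where A: "A \<subseteq> X \<times> X" "g \<in> beta_set A" "beta_set A \<subseteq> U1"
      by (rule openin_betaE[OF oU(1) U(3)])
    obtain B where B: "B \<subseteq> X \<times> X" "h \<in> beta_set B" "beta_set B \<subseteq> U2"
      by (rule openin_betaE[OF oU(2) U(4)])
    have "\<exists>x y z. (x, y) \<in> A \<and> (y, z) \<in> B"
      by (rule composable_happens[OF g h c]) (use A(2) B(2) in \<open>simp_all add: beta_set_def\<close>)
    then obtain x y z where xyz: "(x, y) \<in> A" "(y, z) \<in> B" by (elim exE conjE)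
    then have X: "x \<in> X" "y \<in> X" "z \<in> X" using A(1) B(1) by auto
    have "beta_point (x, y) \<in> U1" "beta_point (y, z) \<in> U2"
      using xyz A(3) B(3) by (auto simp: subset_iff)
    then have "(beta_point (x, y), beta_point (y, z)) \<in> W" using U(5) by (simp add: subset_iff)
    moreover have "coarse_src X d (beta_point (x, y)) = coarse_rng X d (beta_point (y, z))"
      by (simp add: coarse_src_eq coarse_rng_eq beta_point_in_coarse X)
    ultimately have "(beta_point (x, y), beta_point (y, z)) \<in> V" by (simp add: VW)
    moreover have "(beta_point (x, y), beta_point (y, z)) \<in> ?P"
      using X by (intro image_eqI[of _ _ "(x, y, z)"]) simp_all
    ultimately show ?thesis by (intro bexI[of _ "(beta_point (x, y), beta_point (y, z))"])
  qed
  with gh show "gh \<in> coarse_composable X d closure_of ?P"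
    by (simp add: in_closure_of)
qed

lemma bounded_geometry_partial_function:
  assumes bg: "bounded_geometry X d" and S: "0 \<le> S" and h: "h \<in> beta_set (entourage X d S)"
  shows "\<exists>B. h \<in> beta_set B \<and> (\<forall>y z z'. (y, z) \<in> B \<longrightarrow> (y, z') \<in> B \<longrightarrow> z = z')"
proof -
  let ?N = "\<lambda>y. {z. (y, z) \<in> entourage X d S}"
  have "0 < S + 1" using S by simp
  with bg obtain n where n: "\<And>y. y \<in> X \<Longrightarrow> finite (Metric_space.mball X d y (S + 1)) \<and>
        card (Metric_space.mball X d y (S + 1)) \<le> n"
    unfolding bounded_geometry_def by blast
  have N: "finite (?N y) \<and> card (?N y) \<le> n" for y
  proof (cases "y \<in> X")
    case True
    have sub: "?N y \<subseteq> Metric_space.mball X d y (S + 1)"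
      by (auto simp: entourage_def Metric_space.in_mball[OF metric])
    show ?thesis using n[OF True] finite_subset[OF sub] card_mono[OF _ sub] by linarith
  next
    case False
    then have "?N y = {}" by (simp add: entourage_def)
    then show ?thesis by simp
  qed
  have "\<forall>y. \<exists>f. inj_on f (?N y) \<and> f ` ?N y \<subseteq> {..<n}"
  proof
    fix y
    obtain f where f: "bij_betw f (?N y) {0..<card (?N y)}"
      using ex_bij_betw_finite_nat[of "?N y"] N[of y] by blast
    have "f ` ?N y = {0..<card (?N y)}" using f by (rule bij_betw_imp_surj_on)
    moreover have "{0..<card (?N y)} \<subseteq> {..<n}" using N[of y] by auto
    ultimately show "\<exists>f. inj_on f (?N y) \<and> f ` ?N y \<subseteq> {..<n}"
      using bij_betw_imp_inj_on[OF f] by (intro exI[of _ f]) simp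
  qed
  from choice[OF this] obtain f where f: "\<And>y. inj_on (f y) (?N y)" "\<And>y. f y ` ?N y \<subseteq> {..<n}"
    by auto
  let ?B = "\<lambda>i. {(y, z) \<in> entourage X d S. f y z = i}"
  have "entourage X d S = (\<Union>i\<in>{..<n}. ?B i)" using f(2) by fast
  then have "h \<in> beta_set (\<Union>i\<in>{..<n}. ?B i)" using h by simp
  then have "h \<in> (\<Union>i\<in>{..<n}. beta_set (?B i))" by (simp only: beta_set_UN finite_lessThan)
  then obtain i where i: "h \<in> beta_set (?B i)" by (rule UN_E)
  have "\<forall>y z z'. (y, z) \<in> ?B i \<longrightarrow> (y, z') \<in> ?B i \<longrightarrow> z = z'"
    using f(1) by (auto simp: inj_on_def)
  with i show ?thesis by blast
qed

lemma coarse_comp_in: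
  assumes bg: "bounded_geometry X d" and R: "0 \<le> R" and S: "0 \<le> S"
    and g: "g \<in> beta_set (entourage X d R)" and h: "h \<in> beta_set (entourage X d S)"
    and c: "coarse_src X d g = coarse_rng X d h"
  shows "coarse_comp g h \<in> beta_set (entourage X d (R + S))"
proof -
  note gG = coarse_setI[OF R g] and hG = coarse_setI[OF S h]
  have nb: "coarse_comp g h \<noteq> bot"
  proof
    assume "coarse_comp g h = bot"
    then have "eventually (\<lambda>_. False) (coarse_comp g h)" by simp
    then obtain A B where AB: "eventually A g" "eventually B h" "\<forall>x y z. A (x, y) \<longrightarrow> B (y, z) \<longrightarrow> False"
      unfolding eventually_coarse_comp by (elim exE conjE)
    with composable_happens[OF gG hG c AB(1,2)] show False by blast
  qed
  obtain B where B: "h \<in> beta_set B" "\<And>y z z'. (y, z) \<in> B \<Longrightarrow> (y, z') \<in> B \<Longrightarrow> z = z'"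
    using bounded_geometry_partial_function[OF bg S h] by (elim exE conjE) simp
  let ?f = "\<lambda>p. (fst p, THE z. (snd p, z) \<in> B)"
  have "coarse_comp g h \<le> filtermap ?f g"
  proof (rule filter_leI)
    fix P assume "eventually P (filtermap ?f g)"
    then have ev: "eventually (\<lambda>p. P (?f p)) g" by (simp add: eventually_filtermap)
    have evB: "eventually (\<lambda>p. p \<in> B) h" using B(1) by (simp add: beta_set_def)
    have "P (x, z)" if "P (?f (x, y))" "(y, z) \<in> B" for x y z
    proof -
      have "(THE z. (y, z) \<in> B) = z"
      proof (rule the_equality)
        show "(y, z) \<in> B" by (rule that(2))
        show "z' = z" if "(y, z') \<in> B" for z' by (rule B(2)[OF that \<open>(y, z) \<in> B\<close>])
      qed
      with that(1) show ?thesis by simp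
    qed
    with ev evB show "eventually P (coarse_comp g h)" unfolding eventually_coarse_comp
      by (intro exI[of _ "\<lambda>p. P (?f p)"] exI[of _ "\<lambda>p. p \<in> B"] conjI allI impI)
  qed
  note le = this
  have fg: "filtermap ?f g \<in> beta_set UNIV" by (rule filtermap_beta_set[OF g]) simp
  have eq: "coarse_comp g h = filtermap ?f g"
    by (rule ultra_max[OF beta_setD[OF fg] le nb])
  have "(x, z) \<in> entourage X d (R + S)" if "(x, y) \<in> entourage X d R" "(y, z) \<in> entourage X d S" for x y z
    using that Metric_space.triangle[OF metric, of x y z] by (simp add: entourage_def)
  then have "eventually (\<lambda>p. p \<in> entourage X d (R + S)) (coarse_comp g h)"
    unfolding eventually_coarse_comp using g h
    by (intro exI[of _ "\<lambda>p. p \<in> entourage X d R"] exI[of _ "\<lambda>p. p \<in> entourage X d S"])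
      (simp add: beta_set_def)
  moreover have "is_ultrafilter (coarse_comp g h)" unfolding eq by (rule beta_setD[OF fg])
  ultimately show ?thesis by (simp add: beta_set_def)
qed

lemma continuous_map_coarse_comp:
  assumes bg: "bounded_geometry X d"
  shows "continuous_map (coarse_composable X d) (coarse_arrows X d) (\<lambda>(g, h). coarse_comp g h)"
  unfolding continuous_map_def
proof (intro conjI allI impI)
  have mem: "coarse_comp g h \<in> coarse_set X d" if gh: "(g, h) \<in> topspace (coarse_composable X d)" for g h
  proof -
    from gh have g: "g \<in> coarse_set X d" and h: "h \<in> coarse_set X d"
      and c: "coarse_src X d g = coarse_rng X d h"
      by (simp_all add: topspace_coarse_composable)
    obtain R where R: "0 \<le> R" "g \<in> beta_set (entourage X d R)" by (rule coarse_setE[OF g])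
    obtain S where S: "0 \<le> S" "h \<in> beta_set (entourage X d S)" by (rule coarse_setE[OF h])
    show ?thesis
      by (rule coarse_setI[OF add_nonneg_nonneg[OF R(1) S(1)] coarse_comp_in[OF bg R(1) S(1) R(2) S(2) c]])
  qed
  then show "(\<lambda>(g, h). coarse_comp g h) \<in> topspace (coarse_composable X d) \<rightarrow> topspace (coarse_arrows X d)"
    by auto
  fix U assume U: "openin (coarse_arrows X d) U"
  then have oU: "openin (beta (X \<times> X)) U" by (simp add: openin_coarse_arrows)
  let ?V = "{gh \<in> topspace (coarse_composable X d). (case gh of (g, h) \<Rightarrow> coarse_comp g h) \<in> U}"
  show "openin (coarse_composable X d) ?V"
  proof (subst openin_subopen, rule ballI)
    fix gh assume gh: "gh \<in> ?V"
    obtain g h where gh_eq: "gh = (g, h)" by (rule prod.exhaust)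
    with gh have g: "g \<in> coarse_set X d" and h: "h \<in> coarse_set X d"
      and c: "coarse_src X d g = coarse_rng X d h" and ghU: "coarse_comp g h \<in> U"
      by (simp_all add: topspace_coarse_composable)
    obtain R where R: "0 \<le> R" "g \<in> beta_set (entourage X d R)" by (rule coarse_setE[OF g])
    obtain S where S: "0 \<le> S" "h \<in> beta_set (entourage X d S)" by (rule coarse_setE[OF h])
    obtain C where C: "coarse_comp g h \<in> beta_set C" "beta_set C \<subseteq> U"
      by (rule openin_betaE[OF oU ghU])
    have "eventually (\<lambda>p. p \<in> C) (coarse_comp g h)" using C(1) by (simp add: beta_set_def)
    then obtain A B where AB: "eventually A g" "eventually B h"
      "\<forall>x y z. A (x, y) \<longrightarrow> B (y, z) \<longrightarrow> (x, z) \<in> C"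
      unfolding eventually_coarse_comp by (elim exE conjE)
    let ?A = "{p \<in> entourage X d R. A p}" and ?B = "{p \<in> entourage X d S. B p}"
    let ?W = "(beta_set ?A \<times> beta_set ?B) \<inter> {(g, h). coarse_src X d g = coarse_rng X d h}"
    have "openin (prod_topology (coarse_arrows X d) (coarse_arrows X d)) (beta_set ?A \<times> beta_set ?B)"
      unfolding openin_prod_Times_iff
      using openin_coarse_beta_set[of ?A X d R] openin_coarse_beta_set[of ?B X d S] R(1) S(1) by simp
    then have o: "openin (coarse_composable X d) ?W"
      unfolding coarse_composable_def by (rule openin_subtopology_Int)
    have m: "gh \<in> ?W"
      using beta_set_restrict[OF R(2) AB(1)] beta_set_restrict[OF S(2) AB(2)] c by (simp add: gh_eq)
    have "?W \<subseteq> ?V"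
    proof
      fix w assume w: "w \<in> ?W"
      then have wT: "w \<in> topspace (coarse_composable X d)" using openin_subset[OF o] by blast
      obtain g' h' where w_eq: "w = (g', h')" by (rule prod.exhaust)
      have ev: "eventually A g'" "eventually B h'"
        using w beta_set_restrictD[of g' "entourage X d R" A] beta_set_restrictD[of h' "entourage X d S" B]
        by (simp_all add: w_eq)
      have "coarse_comp g' h' \<in> coarse_set X d" using mem wT by (simp add: w_eq)
      then have "is_ultrafilter (coarse_comp g' h')"
        by (elim coarse_setE) (rule beta_setD)
      moreover have "eventually (\<lambda>p. p \<in> C) (coarse_comp g' h')"
        unfolding eventually_coarse_comp
        by (intro exI[of _ A] exI[of _ B] conjI ev) (rule AB(3))
      ultimately have "coarse_comp g' h' \<in> beta_set C" by (simp add: beta_set_def)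
      then show "w \<in> ?V" using wT C(2) by (auto simp: w_eq)
    qed
    with o m show "\<exists>T. openin (coarse_composable X d) T \<and> gh \<in> T \<and> T \<subseteq> ?V"
      by (intro exI[of _ ?W] conjI)
  qed
qed

lemma coarse_comp_beta_point: "coarse_comp (beta_point (x, y)) (beta_point (y, z)) = beta_point (x, z)"
  by (auto simp: filter_eq_iff eventually_coarse_comp
      intro: exI[of _ "\<lambda>p. p = (x, y)"] exI[of _ "\<lambda>p. p = (y, z)"])

theorem coarse_mul_eq:
  assumes bg: "bounded_geometry X d"
    and g: "g \<in> coarse_set X d" and h: "h \<in> coarse_set X d"
    and c: "coarse_src X d g = coarse_rng X d h"
  shows "coarse_mul X d g h = coarse_comp g h"
proof -
  have "coarse_mul X d g h = (\<lambda>(g, h). coarse_comp g h) (g, h)"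
    unfolding coarse_mul_def
  proof (rule continuous_extension_eq[OF Hausdorff_coarse_arrows composable_dense
          continuous_map_coarse_comp[OF bg]])
    show "(g, h) \<in> topspace (coarse_composable X d)"
      using g h c by (simp add: topspace_coarse_composable)
    fix p assume "p \<in> X \<times> X \<times> X"
    then obtain x y z where p: "p = (x, y, z)" and X: "x \<in> X" "y \<in> X" "z \<in> X" by auto
    show "(\<lambda>(x, y, z). (beta_point (x, y), beta_point (y, z))) p \<in> topspace (coarse_composable X d) \<and>
      (\<lambda>(g, h). coarse_comp g h) ((\<lambda>(x, y, z). (beta_point (x, y), beta_point (y, z))) p) =
      (\<lambda>(x, y, z). beta_point (x, z)) p"
      by (simp add: p coarse_comp_beta_point topspace_coarse_composable beta_point_in_coarse X
          coarse_src_eq coarse_rng_eq)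
  qed
  then show ?thesis by simp
qed

theorem coarse_length_extension:
  defines "L \<equiv> continuous_extension (beta (X \<times> X)) beta_point (X \<times> X) euclidean (\<lambda>(x, y). ennreal (d x y))"
  shows "continuous_map (beta (X \<times> X)) euclidean L"
    and "\<And>x y. x \<in> X \<Longrightarrow> y \<in> X \<Longrightarrow> L (beta_point (x, y)) = ennreal (d x y)"
    and "\<And>R z. z \<in> entourage_closure X d R \<Longrightarrow> L z \<le> ennreal R"
proof -
  have H: "Hausdorff_space (euclidean :: ennreal topology)"
    unfolding Hausdorff_space_def disjnt_def by (simp add: separation_t2)
  have "\<exists>!g. g \<in> extensional (topspace (beta (X \<times> X))) \<and> continuous_map (beta (X \<times> X)) euclidean g \<and>
                (\<forall>p\<in>X \<times> X. g (beta_point p) = (\<lambda>(x, y). ennreal (d x y)) p)"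
    by (rule beta_universal) (simp_all add: compact_space_def compactin_euclidean_iff compact_UNIV H)
  from theI'[OF this] have L: "continuous_map (beta (X \<times> X)) euclidean L"
    and ext: "\<forall>p\<in>X \<times> X. L (beta_point p) = (\<lambda>(x, y). ennreal (d x y)) p"
    unfolding L_def continuous_extension_def by blast+
  show "continuous_map (beta (X \<times> X)) euclidean L" by (rule L)
  show pt: "L (beta_point (x, y)) = ennreal (d x y)" if "x \<in> X" "y \<in> X" for x y
    using bspec[OF ext, of "(x, y)"] that by simp
  fix R z assume z: "z \<in> entourage_closure X d R"
  have "closedin (beta (X \<times> X)) {z \<in> topspace (beta (X \<times> X)). L z \<in> {..ennreal R}}"
    by (rule closedin_continuous_map_preimage[OF L]) simp
  moreover have "beta_point ` entourage X d R \<subseteq> {z \<in> topspace (beta (X \<times> X)). L z \<in> {..ennreal R}}"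
    by (auto simp: entourage_def pt intro: ennreal_leI)
  ultimately have "entourage_closure X d R \<subseteq> {z \<in> topspace (beta (X \<times> X)). L z \<in> {..ennreal R}}"
    unfolding entourage_closure_def by (rule closure_of_minimal[rotated])
  with z show "L z \<le> ennreal R" by auto
qed

end

end

theory Submission
  imports Defs
begin

text \<open>
  A cover realising the dynamic asymptotic dimension at scale \<open>R = 2 l + r\<close> restricts to a
  decomposition of \<open>X\<close> into \<open>m + 1\<close> sets \<open>V i\<close> whose \<open>R\<close>-chain components have uniformly bounded
  diameter: the precompact subgroupoids are bounded equivalence relations.
  Give the component of \<open>V i\<close> near \<open>x\<close> the weight \<open>exp (c * max 0 (l - d(x, V i))) - 1\<close>. If
  \<open>exp (c * l) \<ge> m + 2\<close>, then the total weight at \<open>x\<close> is at least \<open>m + 1\<close>, and moving \<open>x\<close> by at most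
  \<open>r\<close> changes the weights by at most a multiple of \<open>exp (c * r) - 1\<close> of the total weight.
  Subexponential growth of \<open>m\<close> is exactly what allows \<open>c\<close> to be arbitrarily small. Normalising
  and moving the mass to a representative of each component yields Property A for \<open>X\<close>.

  The resulting kernel on \<open>X \<times> X\<close> extends continuously to the coarse groupoid. By bounded geometry
  each source fibre of \<open>G(X)\<close> is enumerated by finitely many partial sections of \<open>X\<close>, so that
  the fibre sums over an ultrafilter \<open>k\<close> are limits along \<open>k\<close> of the corresponding sums over \<open>X\<close>.
\<close>

section \<open>Weights on a decomposed metric space\<close>

context Metric_space
begin

text \<open>Inserting 0 truncates the supremum to \<open>max 0 (l - d(x, V))\<close> and gives the
  empty set depth 0, so an empty \<open>V\<close> needs no separate treatment.\<close>

definition depth :: "real \<Rightarrow> 'a set \<Rightarrow> 'a \<Rightarrow> real" where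
  "depth l V x = Sup (insert 0 ((\<lambda>v. l - d x v) ` V))"

lemma depth_bdd_above: "bdd_above (insert 0 ((\<lambda>v. l - d x v) ` V))"
proof (rule bdd_aboveI[of _ "max 0 l"])
  fix a assume "a \<in> insert 0 ((\<lambda>v. l - d x v) ` V)"
  then show "a \<le> max 0 l" using nonneg[of x] by (auto simp: max_def) (smt (verit) nonneg)+
qed

lemma depth_nonneg: "0 \<le> depth l V x"
  unfolding depth_def by (rule cSup_upper[OF _ depth_bdd_above]) simp

lemma depth_ge: "v \<in> V \<Longrightarrow> l - d x v \<le> depth l V x"
  unfolding depth_def by (rule cSup_upper[OF _ depth_bdd_above]) simp

lemma depth_pos_imp_near:
  assumes "0 < depth l V x"
  shows "\<exists>v\<in>V. d x v < l"
proof -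
  have "\<exists>a\<in>insert 0 ((\<lambda>v. l - d x v) ` V). 0 < a"
    using assms less_cSup_iff[OF _ depth_bdd_above, of l x V 0] unfolding depth_def by blast
  then show ?thesis by auto
qed

text \<open>A supremum of 1-Lipschitz functions is 1-Lipschitz.\<close>

lemma depth_le_add_dist:
  assumes "x \<in> M" "y \<in> M" "V \<subseteq> M"
  shows "depth l V x \<le> depth l V y + d x y"
  unfolding depth_def[of l V x]
proof (rule cSup_least)
  fix a assume "a \<in> insert 0 ((\<lambda>v. l - d x v) ` V)"
  then consider "a = 0" | v where "v \<in> V" "a = l - d x v" by blast
  then show "a \<le> depth l V y + d x y"
  proof cases
    case 1
    then show ?thesis using depth_nonneg[of l V y] nonneg[of x y] by simp
  next
    case 2
    have "d y v \<le> d y x + d x v" using assms 2(1) by (intro triangle) auto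
    then show ?thesis using depth_ge[OF 2(1), of l y] 2(2) commute[of x y] by simp
  qed
qed simp

text \<open>Subtracting 1 makes the weight vanish off the \<open>l\<close>-neighbourhood of
  \<open>V\<close>; the exponential turns the additive Lipschitz bound on the depth into a
  multiplicative one.\<close>

definition weight :: "real \<Rightarrow> real \<Rightarrow> 'a set \<Rightarrow> 'a \<Rightarrow> real" where
  "weight c l V x = exp (c * depth l V x) - 1"

lemma weight_nonneg: "0 \<le> c \<Longrightarrow> 0 \<le> weight c l V x"
  by (simp add: weight_def depth_nonneg)

lemma weight_nonzero_imp_near: "weight c l V x \<noteq> 0 \<Longrightarrow> \<exists>v\<in>V. d x v < l"
  using depth_pos_imp_near[of l V x] depth_nonneg[of l V x] by (force simp: weight_def)

lemma weight_ge:
  assumes "0 \<le> c" "x \<in> V" "x \<in> M"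
  shows "exp (c * l) - 1 \<le> weight c l V x"
  using depth_ge[OF assms(2), of l x] assms by (simp add: weight_def mult_left_mono)

text \<open>Moving \<open>x\<close> by at most \<open>r\<close> multiplies \<open>weight + 1\<close>
  by a factor between \<open>exp (- c * r)\<close> and \<open>exp (c * r)\<close>. The additive 1 on
  the right is harmless once the total weight dominates the number of sets.\<close>

lemma weight_diff:
  assumes c: "0 \<le> c" and xy: "x \<in> M" "y \<in> M" "V \<subseteq> M" "d x y \<le> r"
  shows "\<bar>weight c l V x - weight c l V y\<bar> \<le> (exp (c * r) - 1) * (weight c l V x + 1)"
proof -
  let ?a = "c * depth l V x" and ?b = "c * depth l V y"
  have "depth l V x \<le> depth l V y + r" "depth l V y \<le> depth l V x + r"
    using depth_le_add_dist[of x y V l] depth_le_add_dist[of y x V l] xy commute[of x y] by auto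
  then have "?a \<le> ?b + c * r" "?b \<le> ?a + c * r"
    using c by (metis distrib_left mult_left_mono)+
  then have *: "exp ?a \<le> exp ?b * exp (c * r)" "exp ?b \<le> exp ?a * exp (c * r)"
    by (simp_all flip: exp_add)
  have "0 \<le> r" using nonneg xy(4) by (rule order_trans)
  then have E: "1 \<le> exp (c * r)" using c by simp
  \<comment> \<open>Both signs of the difference are to be bounded by the weight at
    \<open>x\<close>, so here the smaller \<open>exp ?b\<close> is replaced by
    \<open>exp ?a\<close>.\<close>
  have "exp ?a - exp ?b \<le> exp ?a * (exp (c * r) - 1)"
  proof (cases "exp ?a \<le> exp ?b")
    case True
    then show ?thesis using E by (smt (verit) exp_gt_zero mult_nonneg_nonneg)
  next
    case False
    have "exp ?a - exp ?b \<le> exp ?b * (exp (c * r) - 1)" using *(1) by (simp add: algebra_simps)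
    also have "\<dots> \<le> exp ?a * (exp (c * r) - 1)" using False E by (intro mult_right_mono) auto
    finally show ?thesis .
  qed
  then show ?thesis using *(2) by (simp add: weight_def abs_if algebra_simps)
qed

end

text \<open>Each term splits into the change of the numerator and the change of the total. Since the
  total changes by at most the sum of the numerator changes, each part contributes at most
  \<open>e\<close>.\<close>

lemma normalized_diff:
  fixes w w' :: "'i \<Rightarrow> real"
  assumes nn: "\<And>i. i \<in> I \<Longrightarrow> 0 \<le> w' i"
    and pos: "0 < sum w I" "0 < sum w' I" and le: "(\<Sum>i\<in>I. \<bar>w i - w' i\<bar>) \<le> e * sum w I"
  shows "(\<Sum>i\<in>I. \<bar>w i / sum w I - w' i / sum w' I\<bar>) \<le> 2 * e"
proof -
  let ?W = "sum w I" and ?W' = "sum w' I"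
  have "\<bar>w i / ?W - w' i / ?W'\<bar> \<le> \<bar>w i - w' i\<bar> / ?W + w' i * (\<bar>?W' - ?W\<bar> / (?W * ?W'))"
    if "i \<in> I" for i
  proof -
    have "w i / ?W - w' i / ?W' = (w i - w' i) / ?W + w' i * ((?W' - ?W) / (?W * ?W'))"
      using pos by (simp add: field_simps)
    also have "\<bar>\<dots>\<bar> \<le> \<bar>(w i - w' i) / ?W\<bar> + \<bar>w' i * ((?W' - ?W) / (?W * ?W'))\<bar>"
      by (rule abs_triangle_ineq)
    finally show ?thesis using pos nn[OF that] by (simp add: abs_mult)
  qed
  then have "(\<Sum>i\<in>I. \<bar>w i / ?W - w' i / ?W'\<bar>) \<le>
      (\<Sum>i\<in>I. \<bar>w i - w' i\<bar> / ?W + w' i * (\<bar>?W' - ?W\<bar> / (?W * ?W')))"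
    by (rule sum_mono)
  also have "\<dots> = (\<Sum>i\<in>I. \<bar>w i - w' i\<bar>) / ?W + ?W' * (\<bar>?W' - ?W\<bar> / (?W * ?W'))"
    by (simp only: sum.distrib sum_divide_distrib sum_distrib_right)
  also have "\<dots> = (\<Sum>i\<in>I. \<bar>w i - w' i\<bar>) / ?W + \<bar>?W' - ?W\<bar> / ?W"
    using pos by simp
  also have "\<dots> \<le> e + e"
  proof (rule add_mono)
    show *: "(\<Sum>i\<in>I. \<bar>w i - w' i\<bar>) / ?W \<le> e" using le pos by (simp add: divide_le_eq)
    have "\<bar>?W' - ?W\<bar> = \<bar>\<Sum>i\<in>I. w i - w' i\<bar>" by (simp add: sum_subtractf)
    also have "\<dots> \<le> (\<Sum>i\<in>I. \<bar>w i - w' i\<bar>)" by (rule sum_abs)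
    finally have "\<bar>?W' - ?W\<bar> / ?W \<le> (\<Sum>i\<in>I. \<bar>w i - w' i\<bar>) / ?W"
      using pos by (simp add: divide_right_mono)
    then show "\<bar>?W' - ?W\<bar> / ?W \<le> e" using * by simp
  qed
  finally show ?thesis by simp
qed

text \<open>A zero mass can be relocated at will, so both point masses may be taken to sit at the
  same point \<open>s\<close>. Hence moving weights to representatives does not increase
  l1-distances.\<close>

lemma sum_if_eq_diff:
  fixes a b :: real
  assumes "finite A" and eq: "a \<noteq> 0 \<Longrightarrow> b \<noteq> 0 \<Longrightarrow> p = q"
  shows "(\<Sum>z\<in>A. \<bar>(if p = z then a else 0) - (if q = z then b else 0)\<bar>) \<le> \<bar>a - b\<bar>"
proof -
  define s where "s = (if a = 0 then q else p)"
  have "(\<Sum>z\<in>A. \<bar>(if p = z then a else 0) - (if q = z then b else 0)\<bar>) =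
      (\<Sum>z\<in>A. if s = z then \<bar>a - b\<bar> else 0)"
    using eq by (intro sum.cong refl) (cases "b = 0"; auto simp: s_def)
  also have "\<dots> \<le> \<bar>a - b\<bar>" using assms(1) by simp
  finally show ?thesis .
qed

text \<open>This is Property A in the form of Reiter's condition: probability measures on balls of
  radius \<open>S\<close> that are almost invariant at scale \<open>r\<close>. Sums run over finite
  sets \<open>A\<close>, so that no infinite sums occur before bounded geometry supplies finite
  balls.\<close>

definition reiter_weights ::
    "'a set \<Rightarrow> ('a \<Rightarrow> 'a \<Rightarrow> real) \<Rightarrow> real \<Rightarrow> real \<Rightarrow> real \<Rightarrow> ('a \<Rightarrow> 'a \<Rightarrow> real) \<Rightarrow> bool" where
  "reiter_weights X d r e S \<mu> \<longleftrightarrow>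
     (\<forall>x z. 0 \<le> \<mu> x z) \<and>
     (\<forall>x\<in>X. \<forall>z. \<mu> x z \<noteq> 0 \<longrightarrow> z \<in> X \<and> d x z \<le> S) \<and>
     (\<forall>x\<in>X. \<forall>A. finite A \<longrightarrow> {z \<in> X. d x z \<le> S} \<subseteq> A \<longrightarrow> sum (\<mu> x) A = 1) \<and>
     (\<forall>x\<in>X. \<forall>y\<in>X. \<forall>A. d x y \<le> r \<longrightarrow> finite A \<longrightarrow> (\<Sum>z\<in>A. \<bar>\<mu> x z - \<mu> y z\<bar>) \<le> e)"

lemma
  assumes "reiter_weights X d r e S \<mu>"
  shows reiter_weights_nonneg: "0 \<le> \<mu> x z"
    and reiter_weights_support: "x \<in> X \<Longrightarrow> \<mu> x z \<noteq> 0 \<Longrightarrow> z \<in> X \<and> d x z \<le> S"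
    and reiter_weights_sum:
      "x \<in> X \<Longrightarrow> finite A \<Longrightarrow> {z \<in> X. d x z \<le> S} \<subseteq> A \<Longrightarrow> sum (\<mu> x) A = 1"
    and reiter_weights_diff:
      "x \<in> X \<Longrightarrow> y \<in> X \<Longrightarrow> d x y \<le> r \<Longrightarrow> finite A \<Longrightarrow> (\<Sum>z\<in>A. \<bar>\<mu> x z - \<mu> y z\<bar>) \<le> e"
  using assms by (simp_all add: reiter_weights_def)

section \<open>Almost invariant measures from a bounded decomposition\<close>

context Metric_space
begin

text \<open>Each \<open>H i\<close> is a partial equivalence relation with classes of diameter at
  most \<open>S\<close>. The weight \<open>w i x\<close> is sent to a representative of the class
  near \<open>x\<close>. Points at distance at most \<open>r\<close> use the same representative,
  because points of \<open>V i\<close> closer than \<open>l\<close> to each of them are less than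
  \<open>2 * l + r\<close> apart. Hence only the weights have to be compared.\<close>

lemma decomposition_weights:
  fixes V :: "nat \<Rightarrow> 'a set" and H :: "nat \<Rightarrow> 'a \<Rightarrow> 'a \<Rightarrow> bool"
  assumes c: "0 \<le> c" and r: "0 \<le> r" and e: "4 * (exp (c * r) - 1) \<le> e"
    and m: "real m + 2 \<le> exp (c * l)" and cover: "M = (\<Union>i\<le>m. V i)"
    and H_near: "\<And>i x y. i \<le> m \<Longrightarrow> x \<in> V i \<Longrightarrow> y \<in> V i \<Longrightarrow> d x y < 2 * l + r \<Longrightarrow> H i x y"
    and H_sym: "\<And>i x y. i \<le> m \<Longrightarrow> H i x y \<Longrightarrow> H i y x"
    and H_trans: "\<And>i x y z. i \<le> m \<Longrightarrow> H i x y \<Longrightarrow> H i y z \<Longrightarrow> H i x z"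
    and H_bdd: "\<And>i x y. i \<le> m \<Longrightarrow> H i x y \<Longrightarrow> x \<in> M \<and> y \<in> M \<and> d x y \<le> S"
  shows "\<exists>\<mu>. reiter_weights M d r e (l + S) \<mu>"
proof -
  define w where "w i x = weight c l (V i) x" for i x
  define W where "W x = (\<Sum>i\<le>m. w i x)" for x
  define near where "near i x = (SOME v. v \<in> V i \<and> d x v < l)" for i x
  \<comment> \<open>Related points have equal predicates \<open>H i u\<close>, by symmetry and
    transitivity, so \<open>SOME\<close> selects the same representative for a whole class.\<close>
  define p where "p i x = (SOME z. H i (near i x) z)" for i x
  define \<mu> where "\<mu> x z = (\<Sum>i\<le>m. if p i x = z then w i x / W x else 0)" for x z
  have V: "V i \<subseteq> M" if "i \<le> m" for i using cover that by blast
  have w: "0 \<le> w i x" for i x by (simp add: w_def weight_nonneg c)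
  have W: "real m + 1 \<le> W x" if x: "x \<in> M" for x
  proof -
    obtain i where i: "i \<le> m" "x \<in> V i" using cover x by blast
    have "real m + 1 \<le> w i x" using weight_ge[OF c i(2) x, of l] m by (simp add: w_def)
    also have "\<dots> \<le> W x" unfolding W_def by (rule member_le_sum) (use i w in auto)
    finally show ?thesis .
  qed
  have near: "near i x \<in> V i \<and> d x (near i x) < l" if "w i x \<noteq> 0" for i x
  proof -
    have "\<exists>v. v \<in> V i \<and> d x v < l"
      using weight_nonzero_imp_near[of c l "V i" x] that by (auto simp: w_def)
    then show ?thesis unfolding near_def by (rule someI_ex)
  qed
  have H_near_near: "H i (near i x) (near i y)"
    if i: "i \<le> m" and x: "x \<in> M" "w i x \<noteq> 0" and y: "y \<in> M" "w i y \<noteq> 0" and xy: "d x y \<le> r" for i x y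
  proof -
    let ?u = "near i x" and ?v = "near i y"
    have M: "?u \<in> M" "?v \<in> M" using near[OF x(2)] near[OF y(2)] V[OF i] by auto
    have "d ?u ?v \<le> d ?u x + d x ?v" "d x ?v \<le> d x y + d y ?v"
      using M x y by (auto intro: triangle)
    then have "d ?u ?v < 2 * l + r" using near[OF x(2)] near[OF y(2)] xy commute[of ?u x] by simp
    then show ?thesis using near[OF x(2)] near[OF y(2)] by (intro H_near[OF i]) auto
  qed
  have p_eq: "p i x = p i y"
    if "i \<le> m" "x \<in> M" "w i x \<noteq> 0" "y \<in> M" "w i y \<noteq> 0" "d x y \<le> r" for i x y
  proof -
    have "H i (near i x) (near i y)" by (rule H_near_near) (use that in auto)
    then have "H i (near i x) = H i (near i y)"
      using H_sym[OF that(1)] H_trans[OF that(1)] by blast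
    then show ?thesis by (simp add: p_def)
  qed
  have p: "p i x \<in> M \<and> d x (p i x) \<le> l + S" if i: "i \<le> m" and x: "x \<in> M" "w i x \<noteq> 0" for i x
  proof -
    \<comment> \<open>\<open>H i\<close> is not assumed reflexive; comparing \<open>x\<close> with
      itself yields the witness that \<open>SOME\<close> requires.\<close>
    have "H i (near i x) (near i x)" using H_near_near[OF i x x] x r by simp
    then have "H i (near i x) (p i x)" unfolding p_def by (rule someI)
    from H_bdd[OF i this] have *: "near i x \<in> M" "p i x \<in> M" "d (near i x) (p i x) \<le> S" by auto
    have "d x (p i x) \<le> d x (near i x) + d (near i x) (p i x)" using x * by (intro triangle)
    then show ?thesis using * near[OF x(2)] by simp
  qed
  have \<mu>_nonneg: "0 \<le> \<mu> x z" for x z unfolding \<mu>_def W_def using w by (auto intro!: sum_nonneg divide_nonneg_nonneg)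
  have supp: "z \<in> M \<and> d x z \<le> l + S" if x: "x \<in> M" and nz: "\<mu> x z \<noteq> 0" for x z
  proof -
    obtain i where "i \<le> m" "p i x = z" "w i x \<noteq> 0"
      using nz unfolding \<mu>_def by (force elim!: sum.not_neutral_contains_not_neutral split: if_splits)
    then show ?thesis using p[of i x] x by auto
  qed
  have sum1: "sum (\<mu> x) A = 1" if x: "x \<in> M" and A: "finite A" "{z \<in> M. d x z \<le> l + S} \<subseteq> A" for x A
  proof -
    have "sum (\<mu> x) A = (\<Sum>i\<le>m. \<Sum>z\<in>A. if p i x = z then w i x / W x else 0)"
      unfolding \<mu>_def by (rule sum.swap)
    also have "\<dots> = (\<Sum>i\<le>m. w i x / W x)"
    proof (rule sum.cong)
      fix i assume "i \<in> {..m}"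
      then have "w i x \<noteq> 0 \<Longrightarrow> p i x \<in> A" using p[of i x] x A(2) by auto
      then show "(\<Sum>z\<in>A. if p i x = z then w i x / W x else 0) = w i x / W x"
        using A(1) by auto
    qed simp
    also have "\<dots> = 1" using W[OF x] by (simp add: W_def flip: sum_divide_distrib)
    finally show ?thesis .
  qed
  have diff: "(\<Sum>z\<in>A. \<bar>\<mu> x z - \<mu> y z\<bar>) \<le> e"
    if xy: "x \<in> M" "y \<in> M" "d x y \<le> r" and A: "finite A" for x y A
  proof -
    let ?f = "\<lambda>x i z. if p i x = z then w i x / W x else 0"
    have E: "0 \<le> exp (c * r) - 1" using c r by simp
    have "(\<Sum>z\<in>A. \<bar>\<mu> x z - \<mu> y z\<bar>) \<le> (\<Sum>z\<in>A. \<Sum>i\<le>m. \<bar>?f x i z - ?f y i z\<bar>)"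
      unfolding \<mu>_def sum_subtractf[symmetric] by (intro sum_mono sum_abs)
    also have "\<dots> = (\<Sum>i\<le>m. \<Sum>z\<in>A. \<bar>?f x i z - ?f y i z\<bar>)" by (rule sum.swap)
    also have "\<dots> \<le> (\<Sum>i\<le>m. \<bar>w i x / W x - w i y / W y\<bar>)"
      by (rule sum_mono, rule sum_if_eq_diff[OF A]) (use p_eq xy in auto)
    \<comment> \<open>One factor 2 comes from the normalisation, the other from absorbing the
      additive \<open>m + 1\<close> into \<open>W x\<close>; together they give the 4 in the
      hypothesis on \<open>e\<close>.\<close>
    also have "\<dots> \<le> 2 * (2 * (exp (c * r) - 1))"
      unfolding W_def
    proof (rule normalized_diff)
      have "(\<Sum>i\<le>m. \<bar>w i x - w i y\<bar>) \<le> (\<Sum>i\<le>m. (exp (c * r) - 1) * (w i x + 1))"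
        unfolding w_def by (intro sum_mono weight_diff) (use c xy V in auto)
      also have "\<dots> = (exp (c * r) - 1) * (W x + (real m + 1))"
        by (simp add: W_def sum.distrib add_ac flip: sum_distrib_left)
      also have "\<dots> \<le> (exp (c * r) - 1) * (W x + W x)"
        using W[OF xy(1)] E by (intro mult_left_mono) auto
      finally show "(\<Sum>i\<le>m. \<bar>w i x - w i y\<bar>) \<le> 2 * (exp (c * r) - 1) * (\<Sum>i\<le>m. w i x)"
        by (simp add: W_def algebra_simps)
      show "0 < (\<Sum>i\<le>m. w i x)" "0 < (\<Sum>i\<le>m. w i y)"
        using W[OF xy(1)] W[OF xy(2)] by (simp_all add: W_def)
    qed (rule w)
    finally show ?thesis using e by simp
  qed
  have "reiter_weights M d r e (l + S) \<mu>"
    unfolding reiter_weights_def using \<mu>_nonneg supp sum1 diff by blast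
  then show ?thesis by blast
qed

end

section \<open>Covers of small cardinality\<close>

text \<open>An infimum of a nonempty set in the well-order \<open>enat\<close> is attained, and a
  finite bound rules out the empty set, whose infimum is infinite.\<close>

lemma dad_attained:
  assumes "ereal_of_enat (dad G len R) \<le> ereal b"
  obtains m U where "dad_cover G {z \<in> topspace (arrows G). len z < R} m U" "real m \<le> b"
proof -
  let ?A = "{m. \<exists>U. dad_cover G {z \<in> topspace (arrows G). len z < R} m U}"
  have "?A \<noteq> {}"
  proof
    assume "?A = {}"
    then have "dad G len R = \<infinity>" by (simp add: dad_def top_enat_def)
    with assms show False by simp
  qed
  then obtain m where "m \<in> ?A" by blast
  then have "enat m \<in> enat ` ?A" by (rule imageI)
  then have "dad G len R \<in> enat ` ?A" unfolding dad_def by (rule wellorder_InfI)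
  then obtain m where "m \<in> ?A" "dad G len R = enat m" by blast
  with assms that show thesis by auto
qed

text \<open>The growth bound evaluates \<open>f\<close> at an argument of slope \<open>2 * k\<close>
  in \<open>l\<close>. Subexponentiality puts \<open>f\<close> below an exponential of a rate so
  small that half of the exponent \<open>c * l\<close> absorbs this growth; for large
  \<open>l\<close> the other half absorbs all constants.\<close>

lemma subexponential_dad_growth_cover:
  assumes sub: "subexponential_dad_growth G len" and "0 < c" and "0 \<le> r"
  obtains l m U where "0 < l" "real m + 2 \<le> exp (c * l)"
    "dad_cover G {z \<in> topspace (arrows G). len z < 2 * l + r} m U"
proof -
  obtain f k where f: "subexponential_growth f"
    and k: "\<And>x. real k < x \<Longrightarrow>
      ereal_of_enat (dad G len x) \<le> ereal (real k) * ereal (f (real k * x + real k)) + ereal (real k)"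
    using sub unfolding subexponential_dad_growth_def growth_le_def by blast
  \<comment> \<open>The rate satisfies \<open>2 * k * q \<le> c / 2\<close>; the summand 1 keeps the
    denominator positive when \<open>k = 0\<close>.\<close>
  define q where "q = c / (4 * (real k + 1))"
  have q: "0 < q" using \<open>0 < c\<close> by (simp add: q_def)
  have kq: "4 * real k * q \<le> c" using \<open>0 < c\<close> by (simp add: q_def field_simps)
  let ?t = "\<lambda>l. real k * (2 * l + r) + real k"
  have "((\<lambda>t. f t / exp q powr t) \<longlongrightarrow> 0) at_top"
    using f q by (simp add: subexponential_growth_def)
  then have "eventually (\<lambda>t. f t / exp q powr t < 1) at_top"
    by (rule order_tendstoD) simp
  then obtain T where T: "\<And>t. T \<le> t \<Longrightarrow> f t < exp (q * t)"
    by (auto simp: eventually_at_top_linorder powr_def mult.commute)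
  \<comment> \<open>The entries ensure, in order, positivity, validity of the growth bound at
    \<open>2 * l + r\<close>, the exponential bound on \<open>f\<close>, and that
    \<open>c * l / 2\<close> exceeds the constant part of the exponent.\<close>
  define l where "l = Max {1, real k, T, 2 * (ln (2 * real k + 2) + q * (real k * r + real k)) / c}"
  have l: "1 \<le> l" "real k \<le> l" "T \<le> l" "2 * (ln (2 * real k + 2) + q * (real k * r + real k)) / c \<le> l"
    by (simp_all add: l_def)
  let ?b = "real k * f (?t l) + real k"
  have le: "?b + 2 \<le> exp (c * l)"
  proof -
    have t: "0 \<le> ?t l" using l \<open>0 \<le> r\<close> by (intro add_nonneg_nonneg mult_nonneg_nonneg) auto
    have "real k * f (?t l) \<le> real k * exp (q * ?t l)"
    \<comment> \<open>For \<open>k = 0\<close> the argument of \<open>f\<close> is 0 and may lie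
      below \<open>T\<close>, but then the factor \<open>k\<close> kills the term.\<close>
    proof (cases "k = 0")
      case False
      then have "1 * l \<le> real k * (2 * l + r)" using l \<open>0 \<le> r\<close> by (intro mult_mono) auto
      then have "T \<le> ?t l" using l by simp
      from T[OF this] show ?thesis by (intro mult_left_mono) auto
    qed simp
    moreover have "(real k + 2) * 1 \<le> (real k + 2) * exp (q * ?t l)"
      by (rule mult_left_mono, subst one_le_exp_iff) (use mult_nonneg_nonneg[OF less_imp_le[OF q] t] in simp_all)
    ultimately have "?b + 2 \<le> (2 * real k + 2) * exp (q * ?t l)" by (simp add: algebra_simps)
    also have "\<dots> = exp (ln (2 * real k + 2) + q * ?t l)" by (simp add: exp_add)
    also have "\<dots> \<le> exp (c * l)"
    proof -
      have "2 * (ln (2 * real k + 2) + q * (real k * r + real k)) \<le> l * c"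
        using l(4) \<open>0 < c\<close> by (simp add: divide_le_eq)
      moreover have "4 * real k * q * l \<le> c * l" using kq l by (intro mult_right_mono) auto
      ultimately show ?thesis by (simp add: algebra_simps)
    qed
    finally show ?thesis .
  qed
  have "real k < 2 * l + r" using l \<open>0 \<le> r\<close> by simp
  from k[OF this] have "ereal_of_enat (dad G len (2 * l + r)) \<le> ereal ?b" by simp
  then obtain m U where "dad_cover G {z \<in> topspace (arrows G). len z < 2 * l + r} m U" "real m \<le> ?b"
    by (rule dad_attained)
  with le l show thesis by (intro that[of l m U]) auto
qed

section \<open>Fibres of the coarse groupoid\<close>

lemma entourage_mono: "R \<le> S \<Longrightarrow> entourage X d R \<subseteq> entourage X d S"
  by (auto simp: entourage_def)

text \<open>The sets \<open>beta_set (entourage X d R)\<close> form an increasing open cover, so a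
  finite subcover lies in its largest member.\<close>

lemma compactin_coarse_arrows_bounded:
  assumes "compactin (coarse_arrows X d) K"
  obtains R where "0 \<le> R" "K \<subseteq> beta_set (entourage X d R)"
proof -
  let ?C = "(\<lambda>R. beta_set (entourage X d R)) ` {0..}"
  have "K \<subseteq> \<Union>?C" using compactin_subset_topspace[OF assms] by (simp add: coarse_set_def)
  moreover have "\<forall>C\<in>?C. openin (coarse_arrows X d) C" by (auto intro: openin_coarse_beta_set)
  ultimately obtain \<F> where \<F>: "finite \<F>" "\<F> \<subseteq> ?C" "K \<subseteq> \<Union>\<F>"
    using assms unfolding compactin_def by meson
  then obtain A where A: "finite A" "A \<subseteq> {0..}" "\<F> = (\<lambda>R. beta_set (entourage X d R)) ` A"
    by (meson finite_subset_image)
  \<comment> \<open>Inserting 0 covers the empty subcover, which can occur for empty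
    \<open>K\<close>.\<close>
  let ?R = "Max (insert 0 A)"
  have "beta_set (entourage X d R) \<subseteq> beta_set (entourage X d ?R)" if "R \<in> A" for R
    using A(1) that by (intro beta_set_mono entourage_mono) simp
  then have "K \<subseteq> beta_set (entourage X d ?R)" using \<F>(3) A(3) by blast
  moreover have "0 \<le> ?R" using A(1) by simp
  ultimately show thesis using that by blast
qed

text \<open>Describing the value at an ultrafilter as a limit along it lets sums over fibres be
  computed as limits of sums over \<open>X\<close>.\<close>

lemma beta_extension_tendsto:
  fixes f :: "'a \<Rightarrow> real"
  assumes f: "\<And>p. p \<in> S \<Longrightarrow> f p \<in> {0..1}"
  obtains g where "continuous_map (beta S) (top_of_set {0..1}) g"
    "\<And>F. F \<in> beta_set S \<Longrightarrow> (f \<longlongrightarrow> g F) F"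
proof -
  let ?Y = "top_of_set {0..1::real}"
  have "compact_space ?Y" by (simp add: compact_space_subtopology compactin_euclidean_iff)
  moreover have "Hausdorff_space ?Y" by (intro Hausdorff_space_subtopology) simp
  ultimately have "\<exists>!g. g \<in> extensional (topspace (beta S)) \<and> continuous_map (beta S) ?Y g \<and>
      (\<forall>p\<in>S. g (beta_point p) = f p)"
    using f by (intro beta_universal) auto
  then obtain g where g: "continuous_map (beta S) ?Y g" "\<And>p. p \<in> S \<Longrightarrow> g (beta_point p) = f p"
    by blast
  have "(f \<longlongrightarrow> g F) F" if F: "F \<in> beta_set S" for F
  proof (rule topological_tendstoI)
    fix U assume U: "open U" "g F \<in> U"
    have "openin ?Y ({0..1} \<inter> U)" using U(1) by (simp add: openin_open_Int)
    from openin_continuous_map_preimage[OF g(1) this]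
    have oW: "openin (beta S) {G \<in> topspace (beta S). g G \<in> {0..1} \<inter> U}" .
    have "g F \<in> {0..1}" using continuous_map_image_subset_topspace[OF g(1)] F by auto
    then have FW: "F \<in> {G \<in> topspace (beta S). g G \<in> {0..1} \<inter> U}" using F U(2) by simp
    obtain A where A: "A \<subseteq> S" "F \<in> beta_set A"
      "beta_set A \<subseteq> {G \<in> topspace (beta S). g G \<in> {0..1} \<inter> U}"
      by (rule openin_betaE[OF oW FW])
    have "f p \<in> U" if "p \<in> A" for p
    proof -
      have "beta_point p \<in> beta_set A" using that by simp
      then have "g (beta_point p) \<in> U" using A(3) by blast
      then show ?thesis using g(2)[of p] that A(1) by auto
    qed
    moreover have "eventually (\<lambda>p. p \<in> A) F" using A(2) by (simp add: beta_set_def)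
    ultimately show "eventually (\<lambda>p. f p \<in> U) F" by (auto elim: eventually_mono)
  qed
  with g(1) that show thesis by blast
qed

text \<open>Numbering every ball by an initial segment of a common range yields partial maps
  \<open>t i\<close>, defined at \<open>x\<close> when \<open>i \<in> J x\<close>, whose graphs
  partition an entourage.\<close>

lemma bounded_geometry_sections:
  assumes "Metric_space X d" and bg: "bounded_geometry X d" and S: "0 \<le> S"
  obtains n :: nat and J t where
    "\<And>x. x \<in> X \<Longrightarrow> J x \<subseteq> {..<n}"
    "\<And>x. x \<in> X \<Longrightarrow> bij_betw (\<lambda>i. t i x) (J x) {z \<in> X. d z x \<le> S}"
proof -
  interpret Metric_space X d by fact
  let ?N = "\<lambda>x. {z \<in> X. d z x \<le> S}"
  have "0 < S + 1" using S by simp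
  then obtain n where n: "\<And>x. x \<in> X \<Longrightarrow> finite (mball x (S + 1)) \<and> card (mball x (S + 1)) \<le> n"
    using bg unfolding bounded_geometry_def by blast
  have N: "finite (?N x) \<and> card (?N x) \<le> n" if x: "x \<in> X" for x
  proof -
    have sub: "?N x \<subseteq> mball x (S + 1)" using x by (auto simp: commute)
    show ?thesis using n[OF x] finite_subset[OF sub] card_mono[OF _ sub] by linarith
  qed
  have "\<forall>x\<in>X. \<exists>h. bij_betw h {0..<card (?N x)} (?N x)"
    using N by (blast intro: ex_bij_betw_nat_finite)
  then obtain h where h: "\<And>x. x \<in> X \<Longrightarrow> bij_betw (h x) {0..<card (?N x)} (?N x)"
    by metis
  show thesis
    by (rule that[of "\<lambda>x. {0..<card (?N x)}" n "\<lambda>i x. h x i"]) (use N h in force)+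
qed

section \<open>Enumeration of source fibres by partial sections\<close>

locale coarse_sections = Metric_space X d
  for X :: "'a set" and d :: "'a \<Rightarrow> 'a \<Rightarrow> real" +
  fixes S :: real and n :: nat and J :: "'a \<Rightarrow> nat set" and t :: "nat \<Rightarrow> 'a \<Rightarrow> 'a"
  assumes bg: "bounded_geometry X d"
    and S_nonneg: "0 \<le> S"
    and J: "\<And>x. x \<in> X \<Longrightarrow> J x \<subseteq> {..<n}"
    and t: "\<And>x. x \<in> X \<Longrightarrow> bij_betw (\<lambda>i. t i x) (J x) {z \<in> X. d z x \<le> S}"
begin

text \<open>This is the limit of the index sets \<open>J\<close> along the range of
  \<open>k\<close>.\<close>

definition indices :: "('a \<times> 'a) filter \<Rightarrow> nat set" where
  "indices k = {i. i < n \<and> eventually (\<lambda>p. i \<in> J (fst p)) k}"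

text \<open>This is the limit of the arrows \<open>(t i x, x)\<close> as \<open>x\<close> follows
  the range of \<open>k\<close>.\<close>

definition sect :: "('a \<times> 'a) filter \<Rightarrow> nat \<Rightarrow> ('a \<times> 'a) filter" where
  "sect k i = filtermap (\<lambda>p. (t i (fst p), fst p)) k"

lemma finite_indices: "finite (indices k)"
  by (rule finite_subset[of _ "{..<n}"]) (auto simp: indices_def)

text \<open>An ultrafilter decides each of the finitely many conditions \<open>i \<in> J x\<close>,
  so the index set is constant almost everywhere.\<close>

lemma eventually_indices:
  assumes k: "k \<in> beta_set (entourage X d r)"
  shows "eventually (\<lambda>p. p \<in> entourage X d r \<and> J (fst p) = indices k) k"
proof -
  have ult: "is_ultrafilter k" and E: "eventually (\<lambda>p. p \<in> entourage X d r) k"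
    using k by (simp_all add: beta_set_def)
  have "eventually (\<lambda>p. \<forall>i\<in>{..<n}. i \<in> J (fst p) \<longleftrightarrow> i \<in> indices k) k"
  proof (rule eventually_ball_finite)
    show "\<forall>i\<in>{..<n}. eventually (\<lambda>p. i \<in> J (fst p) \<longleftrightarrow> i \<in> indices k) k"
    proof
      fix i assume i: "i \<in> {..<n}"
      show "eventually (\<lambda>p. i \<in> J (fst p) \<longleftrightarrow> i \<in> indices k) k"
      proof (cases "i \<in> indices k")
        case True
        then show ?thesis by (simp add: indices_def)
      next
        case False
        then show ?thesis using i ultra_not[OF ult, of "\<lambda>p. i \<in> J (fst p)"] by (simp add: indices_def)
      qed
    qed
  qed simp
  with E show ?thesis
  proof eventually_elim
    case (elim p)
    then have "fst p \<in> X" by (auto simp: entourage_def)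
    with J[OF this] elim show ?case by (auto simp: indices_def)
  qed
qed

lemma sect_in:
  assumes k: "k \<in> beta_set (entourage X d r)" and i: "i \<in> indices k"
  shows "sect k i \<in> beta_set {(z, x). x \<in> X \<and> i \<in> J x \<and> z = t i x}"
proof -
  have "k \<in> beta_set {p \<in> entourage X d r. i \<in> J (fst p)}"
    using i by (intro beta_set_restrict[OF k]) (simp add: indices_def)
  then show ?thesis unfolding sect_def
    by (rule filtermap_beta_set) (auto simp: entourage_def)
qed

lemma graph_subset: "{(z, x). x \<in> X \<and> i \<in> J x \<and> z = t i x} \<subseteq> entourage X d S"
proof safe
  fix x assume "x \<in> X" "i \<in> J x"
  then have "t i x \<in> {z \<in> X. d z x \<le> S}" using t[of x] by (auto simp: bij_betw_def)
  with \<open>x \<in> X\<close> show "(t i x, x) \<in> entourage X d S" by (simp add: entourage_def)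
qed

lemma sect_in_entourage:
  "k \<in> beta_set (entourage X d r) \<Longrightarrow> i \<in> indices k \<Longrightarrow> sect k i \<in> beta_set (entourage X d S)"
  using sect_in beta_set_mono[OF graph_subset] by blast

text \<open>Equal ultrafilters would contain the intersection of two graphs, which is empty because
  the numbering of each ball is injective.\<close>

lemma inj_on_sect:
  assumes k: "k \<in> beta_set (entourage X d r)"
  shows "inj_on (sect k) (indices k)"
proof (rule inj_onI, rule ccontr)
  fix i j assume ij: "i \<in> indices k" "j \<in> indices k" "sect k i = sect k j" "i \<noteq> j"
  let ?B = "\<lambda>i. {(z, x). x \<in> X \<and> i \<in> J x \<and> z = t i x}"
  have "sect k i \<in> beta_set (?B i \<inter> ?B j)"
    using sect_in[OF k ij(1)] sect_in[OF k ij(2)] ij(3) by (simp add: beta_set_Int)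
  then obtain x where "x \<in> X" "i \<in> J x" "j \<in> J x" "t i x = t j x"
    using beta_set_nonempty by blast
  with t[of x] ij(4) show False by (auto simp: bij_betw_def inj_on_def)
qed

lemma coarse_rng_filtermap:
  assumes "0 \<le> r" "k \<in> beta_set (entourage X d r)"
  shows "coarse_rng X d k = filtermap (\<lambda>p. (fst p, fst p)) k"
  using coarse_rng_eq[OF Metric_space_axioms coarse_setI[OF assms]] by (simp add: case_prod_unfold)

lemma coarse_src_sect:
  assumes r: "0 \<le> r" and k: "k \<in> beta_set (entourage X d r)" and i: "i \<in> indices k"
  shows "coarse_src X d (sect k i) = coarse_rng X d k"
  unfolding coarse_rng_filtermap[OF r k]
    coarse_src_eq[OF Metric_space_axioms coarse_setI[OF S_nonneg sect_in_entourage[OF k i]]]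
  by (simp add: sect_def filtermap_filtermap case_prod_unfold)

text \<open>For surjectivity, the entourage is covered by finitely many graphs, so an ultrafilter
  \<open>g\<close> on it contains one of them, and on that graph it is determined by its
  source.\<close>

lemma bij_betw_sect:
  assumes r: "0 \<le> r" and k: "k \<in> beta_set (entourage X d r)"
  shows "bij_betw (sect k) (indices k)
    {g \<in> beta_set (entourage X d S). coarse_src X d g = coarse_rng X d k}"
  unfolding bij_betw_def
proof (intro conjI inj_on_sect[OF k] equalityI subsetI)
  fix g assume "g \<in> sect k ` indices k"
  then show "g \<in> {g \<in> beta_set (entourage X d S). coarse_src X d g = coarse_rng X d k}"
    using sect_in_entourage[OF k] coarse_src_sect[OF r k] by blast
next
  fix g assume "g \<in> {g \<in> beta_set (entourage X d S). coarse_src X d g = coarse_rng X d k}"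
  then have g: "g \<in> beta_set (entourage X d S)"
    and src: "filtermap (\<lambda>p. (snd p, snd p)) g = filtermap (\<lambda>p. (fst p, fst p)) k"
    using coarse_src_eq[OF Metric_space_axioms coarse_setI[OF S_nonneg, of g]]
      coarse_rng_filtermap[OF r k] by (simp_all add: case_prod_unfold)
  let ?B = "\<lambda>i. {(z, x). x \<in> X \<and> i \<in> J x \<and> z = t i x}"
  have "entourage X d S \<subseteq> (\<Union>i\<in>{..<n}. ?B i)"
  proof
    fix p assume p: "p \<in> entourage X d S"
    then have x: "snd p \<in> X" and z: "fst p \<in> {z \<in> X. d z (snd p) \<le> S}" by (auto simp: entourage_def)
    then obtain i where "i \<in> J (snd p)" "fst p = t i (snd p)"
      using bij_betw_imp_surj_on[OF t[OF x]] by blast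
    then show "p \<in> (\<Union>i\<in>{..<n}. ?B i)" using J[OF x] x by (auto simp: case_prod_unfold)
  qed
  then have "g \<in> (\<Union>i\<in>{..<n}. beta_set (?B i))"
    using g beta_set_mono[of "entourage X d S"] beta_set_UN[of "{..<n}" ?B] by blast
  then obtain i where i: "i < n" "g \<in> beta_set (?B i)" by blast
  then have ev: "eventually (\<lambda>p. snd p \<in> X \<and> i \<in> J (snd p) \<and> fst p = t i (snd p)) g"
    by (simp add: beta_set_def case_prod_unfold)
  have "eventually (\<lambda>q. i \<in> J (fst q)) (filtermap (\<lambda>p. (snd p, snd p)) g)"
    using ev by (auto simp: eventually_filtermap elim: eventually_mono)
  then have "i \<in> indices k" using i(1) by (simp add: src indices_def eventually_filtermap)
  \<comment> \<open>Almost everywhere the first coordinate is \<open>t i\<close> of the second, so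
    \<open>g\<close> is an image of its source filter.\<close>
  moreover have "g = sect k i"
  proof -
    have "g = filtermap (\<lambda>p. p) g" by (simp add: filtermap_ident)
    also have "\<dots> = filtermap (\<lambda>p. (t i (snd p), snd p)) g"
      unfolding filter_eq_iff eventually_filtermap
    proof
      fix P
      have "eventually (\<lambda>p. P p \<longleftrightarrow> P (t i (snd p), snd p)) g"
        using ev by (rule eventually_mono) (auto simp: split_paired_all)
      then show "eventually P g \<longleftrightarrow> eventually (\<lambda>p. P (t i (snd p), snd p)) g"
        by (rule eventually_subst)
    qed
    also have "\<dots> = filtermap (\<lambda>q. (t i (fst q), fst q)) (filtermap (\<lambda>p. (snd p, snd p)) g)"
      by (simp add: filtermap_filtermap)
    also have "\<dots> = sect k i" by (simp add: src sect_def filtermap_filtermap)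
    finally show ?thesis .
  qed
  ultimately show "g \<in> sect k ` indices k" by blast
qed

text \<open>Beyond radius \<open>S\<close> the terms vanish, and the remaining part of the fibre is
  the finite set enumerated by \<open>sect k\<close>.\<close>

lemma has_sum_src_fibre:
  fixes \<phi> :: "('a \<times> 'a) filter \<Rightarrow> real"
  assumes r: "0 \<le> r" and k: "k \<in> beta_set (entourage X d r)"
    and zero: "\<And>g. g \<in> coarse_set X d \<Longrightarrow> coarse_src X d g = coarse_rng X d k \<Longrightarrow>
      g \<notin> beta_set (entourage X d S) \<Longrightarrow> \<phi> g = 0"
  shows "(\<phi> has_sum (\<Sum>i\<in>indices k. \<phi> (sect k i)))
    (src_fibre (coarse_groupoid X d) (coarse_rng X d k))"
proof -
  let ?F = "{g \<in> beta_set (entourage X d S). coarse_src X d g = coarse_rng X d k}"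
  have "finite ?F" using bij_betw_finite[OF bij_betw_sect[OF r k]] finite_indices by blast
  then have "(\<phi> has_sum sum \<phi> ?F) ?F" by (rule has_sum_finite)
  moreover have "sum \<phi> ?F = (\<Sum>i\<in>indices k. \<phi> (sect k i))"
    by (rule sum.reindex_bij_betw[OF bij_betw_sect[OF r k], symmetric])
  moreover have "?F \<subseteq> src_fibre (coarse_groupoid X d) (coarse_rng X d k)"
    using coarse_setI[OF S_nonneg] by (auto simp: src_fibre_def coarse_groupoid_def)
  then have "(\<phi> has_sum a) ?F \<longleftrightarrow>
      (\<phi> has_sum a) (src_fibre (coarse_groupoid X d) (coarse_rng X d k))" for a
    using zero by (intro has_sum_cong_neutral) (auto simp: src_fibre_def coarse_groupoid_def)
  ultimately show ?thesis by simp
qed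

text \<open>On pairs, \<open>(t i x, x)\<close> times \<open>(x, y)\<close> is
  \<open>(t i x, y)\<close>. One comparison of filters suffices, since an ultrafilter has no proper
  nontrivial refinement.\<close>

lemma coarse_comp_sect:
  assumes r: "0 \<le> r" and k: "k \<in> beta_set (entourage X d r)" and i: "i \<in> indices k"
  shows "coarse_comp (sect k i) k = filtermap (\<lambda>p. (t i (fst p), snd p)) k"
proof -
  have "coarse_comp (sect k i) k \<in> beta_set (entourage X d (S + r))"
    by (rule coarse_comp_in[OF Metric_space_axioms bg S_nonneg r sect_in_entourage[OF k i] k
          coarse_src_sect[OF r k i]])
  then have ult: "is_ultrafilter (coarse_comp (sect k i) k)" by (rule beta_setD)
  have le: "coarse_comp (sect k i) k \<le> filtermap (\<lambda>p. (t i (fst p), snd p)) k"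
  proof (rule filter_leI)
    fix P assume "eventually P (filtermap (\<lambda>p. (t i (fst p), snd p)) k)"
    then have "eventually (\<lambda>p. P (t i (fst p), snd p)) k" by (simp add: eventually_filtermap)
    moreover have "eventually (\<lambda>p. fst p = t i (snd p)) (sect k i)"
      by (simp add: sect_def eventually_filtermap)
    ultimately show "eventually P (coarse_comp (sect k i) k)"
      unfolding eventually_coarse_comp
      by (intro exI[of _ "\<lambda>p. fst p = t i (snd p)"] exI[of _ "\<lambda>p. P (t i (fst p), snd p)"]) auto
  qed
  have "filtermap (\<lambda>p. (t i (fst p), snd p)) k \<in> beta_set UNIV"
    by (rule filtermap_beta_set[OF k]) simp
  from ultra_max[OF beta_setD[OF this] le] ult show ?thesis by (simp add: is_ultrafilter_def)
qed

end

section \<open>Amenability\<close>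

text \<open>By the triangle inequality, multiplication by \<open>k\<close> shortens an arrow by at
  most \<open>r\<close>; otherwise the product filter would contain both the entourage of radius
  \<open>S\<close> and its complement. This bounds the support of the translated kernel.\<close>

lemma coarse_comp_entourage_cancel:
  assumes metric: "Metric_space X d"
    and g: "g \<in> beta_set (entourage X d T)" and k: "k \<in> beta_set (entourage X d r)"
    and gk: "coarse_comp g k \<in> beta_set (entourage X d S)"
  shows "g \<in> beta_set (entourage X d (S + r))"
proof (rule ccontr)
  interpret Metric_space X d by fact
  assume "g \<notin> beta_set (entourage X d (S + r))"
  then have "eventually (\<lambda>p. p \<in> entourage X d T - entourage X d (S + r)) g"
    using g beta_set_Diff[of "entourage X d T" "entourage X d (S + r)"] by (auto simp: beta_set_def)
  moreover have "eventually (\<lambda>p. p \<in> entourage X d r) k" using k by (simp add: beta_set_def)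
  moreover have "(x, z) \<notin> entourage X d S"
    if "(x, y) \<in> entourage X d T - entourage X d (S + r)" "(y, z) \<in> entourage X d r" for x y z
    using that triangle[of x z y] commute[of y z] by (auto simp: entourage_def)
  ultimately have "eventually (\<lambda>p. p \<notin> entourage X d S) (coarse_comp g k)"
    unfolding eventually_coarse_comp by blast
  moreover have "eventually (\<lambda>p. p \<in> entourage X d S) (coarse_comp g k)"
    using gk by (simp add: beta_set_def)
  ultimately have "eventually (\<lambda>p. False) (coarse_comp g k)" by eventually_elim auto
  then show False using beta_setD[OF gk] by (simp add: is_ultrafilter_def)
qed

text \<open>The kernel of the weights extends to the coarse groupoid. Its fibre sums are limits of
  finite sums over balls of \<open>X\<close>, and the estimates for the weights pass to these
  limits.\<close>

lemma amenable_coarse_groupoidI: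
  assumes metric: "Metric_space X d" and bg: "bounded_geometry X d"
    and weights: "\<And>r e. 0 \<le> r \<Longrightarrow> 0 < e \<Longrightarrow> \<exists>S\<ge>0. \<exists>\<mu>. reiter_weights X d r e S \<mu>"
  shows "amenable_groupoid (coarse_groupoid X d)"
  unfolding amenable_groupoid_def
proof (intro allI impI, elim conjE)
  interpret Metric_space X d by (rule metric)
  let ?G = "coarse_groupoid X d"
  fix K and \<epsilon> :: real
  assume K: "compactin (arrows ?G) K" and \<epsilon>: "0 < \<epsilon>"
  obtain r where r: "0 \<le> r" "K \<subseteq> beta_set (entourage X d r)"
    using compactin_coarse_arrows_bounded[of X d K] K by (auto simp: coarse_groupoid_def)
  \<comment> \<open>Limits preserve only weak inequalities; halving recovers the strict one.\<close>
  have "0 < \<epsilon> / 2" using \<epsilon> by simp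
  from weights[OF r(1) this] obtain S \<mu> where S: "0 \<le> S"
    and w: "reiter_weights X d r (\<epsilon> / 2) S \<mu>"
    by blast
  note nonneg = reiter_weights_nonneg[OF w] and supp = reiter_weights_support[OF w]
    and sum1 = reiter_weights_sum[OF w] and diff = reiter_weights_diff[OF w]
  have Sr: "0 \<le> S + r" using S r by simp
  obtain n :: nat and J t where J: "\<And>x. x \<in> X \<Longrightarrow> J x \<subseteq> {..<n}"
    and t: "\<And>x. x \<in> X \<Longrightarrow> bij_betw (\<lambda>i. t i x) (J x) {z \<in> X. d z x \<le> S + r}"
    by (rule bounded_geometry_sections[OF metric bg Sr]) (rule that)
  \<comment> \<open>Translation by an arrow of length at most \<open>r\<close> can enlarge the
    support radius from \<open>S\<close> to \<open>S + r\<close>, so the sections must reach that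
    far.\<close>
  interpret coarse_sections X d "S + r" n J t
    by unfold_locales (fact bg Sr J t)+
  have fin: "finite (J x)" if "x \<in> X" for x using finite_subset[OF J[OF that]] by simp
  have sum_J: "(\<Sum>i\<in>J x. \<mu> x (t i x)) = 1" if x: "x \<in> X" for x
  proof -
    have "(\<Sum>i\<in>J x. \<mu> x (t i x)) = sum (\<mu> x) {z \<in> X. d z x \<le> S + r}"
      by (rule sum.reindex_bij_betw[OF t[OF x]])
    also have "\<dots> = 1"
      by (rule sum1[OF x]) (use bij_betw_finite[OF t[OF x]] fin[OF x] r(1) in \<open>auto simp: commute\<close>)
    finally show ?thesis .
  qed
  have diff_J: "(\<Sum>i\<in>J x. \<bar>\<mu> x (t i x) - \<mu> y (t i x)\<bar>) \<le> \<epsilon> / 2"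
    if xy: "x \<in> X" "y \<in> X" "d x y \<le> r" for x y
  proof -
    have "(\<Sum>i\<in>J x. \<bar>\<mu> x (t i x) - \<mu> y (t i x)\<bar>) = (\<Sum>z | z \<in> X \<and> d z x \<le> S + r. \<bar>\<mu> x z - \<mu> y z\<bar>)"
      by (rule sum.reindex_bij_betw[OF t[OF xy(1)]])
    also have "\<dots> \<le> \<epsilon> / 2"
      by (rule diff[OF xy]) (use bij_betw_finite[OF t[OF xy(1)]] fin[OF xy(1)] in blast)
    finally show ?thesis .
  qed
  \<comment> \<open>The arrow \<open>(z, x)\<close> has source \<open>x\<close>, so a sum over a
    source fibre is a sum of \<open>\<mu> x\<close> over \<open>z\<close>.\<close>
  define f where "f = (\<lambda>p. \<mu> (snd p) (fst p))"
  have f01: "f p \<in> {0..1}" if "p \<in> X \<times> X" for p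
  proof -
    \<comment> \<open>Adding \<open>fst p\<close> to the ball makes \<open>f p\<close> one of the
      nonnegative terms of a sum equal to 1.\<close>
    let ?A = "insert (fst p) {z \<in> X. d z (snd p) \<le> S + r}"
    have p: "snd p \<in> X" using that by auto
    have A: "finite ?A" using bij_betw_finite[OF t[OF p]] fin[OF p] by simp
    have "f p \<le> sum (\<mu> (snd p)) ?A"
      unfolding f_def by (rule member_le_sum) (use nonneg A in auto)
    also have "\<dots> = 1" by (rule sum1[OF p A]) (use r(1) in \<open>auto simp: commute\<close>)
    finally show ?thesis using nonneg by (simp add: f_def)
  qed
  obtain M where M_cont: "continuous_map (beta (X \<times> X)) (top_of_set {0..1}) M"
    and M_lim: "\<And>F. F \<in> beta_set (X \<times> X) \<Longrightarrow> (f \<longlongrightarrow> M F) F"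
    using beta_extension_tendsto[of "X \<times> X" f] f01 by blast
  have M_zero: "M g = 0" if g: "g \<in> coarse_set X d" "g \<notin> beta_set (entourage X d S)" for g
  proof -
    have gX: "g \<in> beta_set (X \<times> X)" using g(1) coarse_set_subset by blast
    then have "g \<in> beta_set (X \<times> X - entourage X d S)" using g(2) by (simp add: beta_set_Diff)
    then have "eventually (\<lambda>p. p \<in> X \<times> X - entourage X d S) g" by (simp add: beta_set_def)
    moreover have "f p = 0" if "p \<in> X \<times> X - entourage X d S" for p
      using supp[of "snd p" "fst p"] that by (auto simp: f_def entourage_def commute)
    ultimately have "eventually (\<lambda>p. f p = 0) g" by (rule eventually_mono)
    then have "(f \<longlongrightarrow> 0) g" by (rule tendsto_eventually)
    moreover have "g \<noteq> bot" using beta_setD[OF gX] by (simp add: is_ultrafilter_def)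
    ultimately show ?thesis using M_lim[OF gX] tendsto_unique by blast
  qed
  have M_lim_map: "((\<lambda>p. f (h p)) \<longlongrightarrow> M (filtermap h k)) k"
    if "filtermap h k \<in> beta_set (X \<times> X)" for h k
    using M_lim[OF that] by (simp add: filterlim_filtermap)
  have M_sum: "(M has_sum 1) (src_fibre ?G (coarse_rng X d k))"
    if r': "0 \<le> r'" and k: "k \<in> beta_set (entourage X d r')" for k r'
  proof -
    have lim: "((\<lambda>p. \<Sum>i\<in>indices k. f (t i (fst p), fst p)) \<longlongrightarrow> (\<Sum>i\<in>indices k. M (sect k i))) k"
      unfolding sect_def
    proof (intro tendsto_sum M_lim_map)
      fix i assume "i \<in> indices k"
      from sect_in_entourage[OF k this] show "filtermap (\<lambda>p. (t i (fst p), fst p)) k \<in> beta_set (X \<times> X)"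
        using beta_set_mono[OF entourage_subset] by (auto simp: sect_def)
    qed
    have ev: "eventually (\<lambda>p. (\<Sum>i\<in>indices k. f (t i (fst p), fst p)) = 1) k"
      using eventually_indices[OF k]
    proof eventually_elim
      case (elim p)
      then have "fst p \<in> X" "indices k = J (fst p)" by (auto simp: entourage_def)
      then show ?case using sum_J by (simp add: f_def)
    qed
    have "k \<noteq> bot" using beta_setD[OF k] by (simp add: is_ultrafilter_def)
    then have "(\<Sum>i\<in>indices k. M (sect k i)) = 1"
      by (rule tendsto_unique[OF _ lim tendsto_eventually[OF ev]])
    moreover have "(M has_sum (\<Sum>i\<in>indices k. M (sect k i))) (src_fibre ?G (coarse_rng X d k))"
      using M_zero r(1) beta_set_mono[OF entourage_mono[of S "S + r" X d]]
      by (intro has_sum_src_fibre[OF r' k]) auto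
    ultimately show ?thesis by simp
  qed
  have M_diff: "(\<Sum>\<^sub>\<infinity>g\<in>src_fibre ?G (coarse_rng X d k). \<bar>M g - M (coarse_mul X d g k)\<bar>) \<le> \<epsilon> / 2"
    if k: "k \<in> beta_set (entourage X d r)" for k
  proof -
    let ?\<phi> = "\<lambda>g. \<bar>M g - M (coarse_mul X d g k)\<bar>"
    have kG: "k \<in> coarse_set X d" by (rule coarse_setI[OF r(1) k])
    have mul: "coarse_mul X d g k = coarse_comp g k"
      if "g \<in> coarse_set X d" "coarse_src X d g = coarse_rng X d k" for g
      by (rule coarse_mul_eq[OF metric bg that(1) kG that(2)])
    have "(?\<phi> has_sum (\<Sum>i\<in>indices k. ?\<phi> (sect k i))) (src_fibre ?G (coarse_rng X d k))"
    proof (rule has_sum_src_fibre[OF r(1) k])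
      fix g assume g: "g \<in> coarse_set X d" "coarse_src X d g = coarse_rng X d k"
        "g \<notin> beta_set (entourage X d (S + r))"
      obtain T where T: "0 \<le> T" "g \<in> beta_set (entourage X d T)" by (rule coarse_setE[OF g(1)])
      have "g \<notin> beta_set (entourage X d S)"
        using g(3) r(1) beta_set_mono[OF entourage_mono[of S "S + r" X d]] by auto
      moreover have "coarse_comp g k \<notin> beta_set (entourage X d S)"
        using coarse_comp_entourage_cancel[OF metric T(2) k] g(3) by blast
      moreover have "coarse_comp g k \<in> coarse_set X d"
        by (rule coarse_setI[OF add_nonneg_nonneg[OF T(1) r(1)] coarse_comp_in[OF metric bg T(1) r(1) T(2) k g(2)]])
      ultimately show "?\<phi> g = 0" using g M_zero mul by simp
    qed
    then have "(\<Sum>\<^sub>\<infinity>g\<in>src_fibre ?G (coarse_rng X d k). ?\<phi> g) = (\<Sum>i\<in>indices k. ?\<phi> (sect k i))"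
      by (rule infsumI)
    also have "\<dots> = (\<Sum>i\<in>indices k. \<bar>M (sect k i) - M (filtermap (\<lambda>p. (t i (fst p), snd p)) k)\<bar>)"
      using mul coarse_setI[OF Sr sect_in_entourage[OF k]] coarse_src_sect[OF r(1) k]
        coarse_comp_sect[OF r(1) k] by (intro sum.cong refl) simp
    \<comment> \<open>At a pair \<open>(x, y)\<close> the arrows \<open>g\<close> and
      \<open>gk\<close> become \<open>(t i x, x)\<close> and \<open>(t i x, y)\<close>, so the
      approximating sum compares \<open>\<mu> x\<close> with \<open>\<mu> y\<close> on a
      ball.\<close>
    also have "\<dots> \<le> \<epsilon> / 2"
    proof (rule tendsto_upperbound)
      show "((\<lambda>p. \<Sum>i\<in>indices k. \<bar>f (t i (fst p), fst p) - f (t i (fst p), snd p)\<bar>) \<longlongrightarrow>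
        (\<Sum>i\<in>indices k. \<bar>M (sect k i) - M (filtermap (\<lambda>p. (t i (fst p), snd p)) k)\<bar>)) k"
        unfolding sect_def
      proof (intro tendsto_sum tendsto_rabs tendsto_diff M_lim_map)
        fix i assume i: "i \<in> indices k"
        from sect_in_entourage[OF k this] show "filtermap (\<lambda>p. (t i (fst p), fst p)) k \<in> beta_set (X \<times> X)"
          using beta_set_mono[OF entourage_subset] by (auto simp: sect_def)
        have "coarse_comp (sect k i) k \<in> beta_set (entourage X d (S + r + r))"
          by (rule coarse_comp_in[OF metric bg Sr r(1) sect_in_entourage[OF k i] k coarse_src_sect[OF r(1) k i]])
        then show "filtermap (\<lambda>p. (t i (fst p), snd p)) k \<in> beta_set (X \<times> X)"
          using coarse_comp_sect[OF r(1) k i] beta_set_mono[OF entourage_subset] by auto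
      qed
      show "eventually (\<lambda>p. (\<Sum>i\<in>indices k. \<bar>f (t i (fst p), fst p) - f (t i (fst p), snd p)\<bar>) \<le> \<epsilon> / 2) k"
        using eventually_indices[OF k]
      proof eventually_elim
        case (elim p)
        then have "fst p \<in> X" "snd p \<in> X" "d (fst p) (snd p) \<le> r" "indices k = J (fst p)"
          by (auto simp: entourage_def)
        then show ?case using diff_J by (simp add: f_def)
      qed
      show "k \<noteq> bot" using beta_setD[OF k] by (simp add: is_ultrafilter_def)
    qed
    finally show ?thesis .
  qed
  show "\<exists>\<mu>. continuous_map (arrows ?G) (top_of_set {0..1}) \<mu> \<and>
    compactin (arrows ?G) (arrows ?G closure_of {g \<in> topspace (arrows ?G). \<mu> g \<noteq> 0}) \<and>
    (\<forall>x\<in>units ?G. \<mu> summable_on src_fibre ?G x \<and> (\<Sum>\<^sub>\<infinity>g\<in>src_fibre ?G x. \<mu> g) \<le> 1) \<and>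
    (\<forall>k\<in>K. \<bar>1 - (\<Sum>\<^sub>\<infinity>g\<in>src_fibre ?G (rng ?G k). \<mu> g)\<bar> < \<epsilon>) \<and>
    (\<forall>k\<in>K. (\<Sum>\<^sub>\<infinity>g\<in>src_fibre ?G (rng ?G k). \<bar>\<mu> g - \<mu> (mul ?G g k)\<bar>) < \<epsilon>)"
  proof (intro exI[of _ M] conjI ballI)
    show "continuous_map (arrows ?G) (top_of_set {0..1}) M"
      using continuous_map_from_subtopology[OF M_cont] by (simp add: coarse_groupoid_def coarse_arrows_eq)
    have comp: "compactin (coarse_arrows X d) (beta_set (entourage X d S))"
      using entourage_closure_compact_open(1)[OF S] by (simp only: entourage_closure_eq)
    have "{g \<in> coarse_set X d. M g \<noteq> 0} \<subseteq> beta_set (entourage X d S)" using M_zero by blast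
    then have "coarse_arrows X d closure_of {g \<in> coarse_set X d. M g \<noteq> 0} \<subseteq> beta_set (entourage X d S)"
      by (rule closure_of_minimal[OF _ compactin_imp_closedin[OF Hausdorff_coarse_arrows comp]])
    from closed_compactin[OF comp this closedin_closure_of]
    show "compactin (arrows ?G) (arrows ?G closure_of {g \<in> topspace (arrows ?G). M g \<noteq> 0})"
      by (simp add: coarse_groupoid_def)
  next
    fix x assume "x \<in> units ?G"
    then have x: "x \<in> beta_set (entourage X d 0)"
      by (simp add: coarse_groupoid_def entourage_closure_eq)
    have "eventually (\<lambda>p. p \<in> entourage X d 0) x" using x by (simp add: beta_set_def)
    moreover have "fst p = snd p" if "p \<in> entourage X d 0" for p
    proof -
      have "fst p \<in> X" "snd p \<in> X" "d (fst p) (snd p) \<le> 0" using that by (auto simp: entourage_def)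
      moreover from this(3) have "d (fst p) (snd p) = 0"
        using Metric_space.nonneg[OF metric] by (rule antisym)
      ultimately show ?thesis using zero by blast
    qed
    ultimately have diag: "eventually (\<lambda>p. fst p = snd p) x" by (rule eventually_mono)
    \<comment> \<open>A unit is concentrated on the diagonal, where the range map is the identity;
      this makes its fibre one of those treated in \<open>M_sum\<close>.\<close>
    have "coarse_rng X d x = x"
      unfolding coarse_rng_filtermap[OF order_refl x] filter_eq_iff eventually_filtermap
    proof
      fix P
      show "eventually (\<lambda>p. P (fst p, fst p)) x \<longleftrightarrow> eventually P x"
        using diag by (intro eventually_subst) (auto elim!: eventually_mono simp: split_paired_all)
    qed
    with M_sum[OF order_refl x] have "(M has_sum 1) (src_fibre ?G x)" by simp
    then show "M summable_on src_fibre ?G x" "(\<Sum>\<^sub>\<infinity>g\<in>src_fibre ?G x. M g) \<le> 1"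
      by (auto simp: infsumI has_sum_imp_summable)
  next
    fix k assume "k \<in> K"
    then have k: "k \<in> beta_set (entourage X d r)" using r(2) by blast
    show "\<bar>1 - (\<Sum>\<^sub>\<infinity>g\<in>src_fibre ?G (rng ?G k). M g)\<bar> < \<epsilon>"
      using infsumI[OF M_sum[OF r(1) k]] \<epsilon> by (simp add: coarse_groupoid_def)
    show "(\<Sum>\<^sub>\<infinity>g\<in>src_fibre ?G (rng ?G k). \<bar>M g - M (mul ?G g k)\<bar>) < \<epsilon>"
      using M_diff[OF k] \<epsilon> by (simp add: coarse_groupoid_def)
  qed
qed

text \<open>Principal ultrafilters embed the pair groupoid of \<open>X\<close>. On them a
  subgroupoid is a partial equivalence relation, and precompactness bounds the lengths of its
  arrows.\<close>

lemma dad_cover_decomposition: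
  assumes metric: "Metric_space X d" and bg: "bounded_geometry X d"
    and cover: "dad_cover (coarse_groupoid X d)
      {z \<in> topspace (arrows (coarse_groupoid X d)). coarse_length X d z < R} m U"
  obtains S V H where "0 \<le> S" "X = (\<Union>i\<le>m. V i)"
    "\<And>i x y. i \<le> m \<Longrightarrow> x \<in> V i \<Longrightarrow> y \<in> V i \<Longrightarrow> d x y < R \<Longrightarrow> H i x y"
    "\<And>i x y. i \<le> m \<Longrightarrow> H i x y \<Longrightarrow> H i y x"
    "\<And>i x y z. i \<le> m \<Longrightarrow> H i x y \<Longrightarrow> H i y z \<Longrightarrow> H i x z"
    "\<And>i x y. i \<le> m \<Longrightarrow> H i x y \<Longrightarrow> x \<in> X \<and> y \<in> X \<and> d x y \<le> S"
proof -
  interpret Metric_space X d by (rule metric)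
  let ?G = "coarse_groupoid X d" and ?K = "{z \<in> coarse_set X d. coarse_length X d z < R}"
  have U: "(\<Union>i\<le>m. U i) = beta_set (entourage X d 0)"
    using cover by (simp add: dad_cover_def coarse_groupoid_def entourage_closure_eq)
  have "\<forall>i\<in>{..m}. \<exists>H. subgroupoid ?G H \<and> precompact_in (arrows ?G) H \<and>
      {g \<in> ?K. coarse_src X d g \<in> U i \<and> coarse_rng X d g \<in> U i} \<subseteq> H"
    using cover by (simp add: dad_cover_def coarse_groupoid_def)
  from bchoice[OF this] obtain P where P: "\<And>i. i \<le> m \<Longrightarrow> subgroupoid ?G (P i)"
    "\<And>i. i \<le> m \<Longrightarrow> precompact_in (arrows ?G) (P i)"
    "\<And>i. i \<le> m \<Longrightarrow> {g \<in> ?K. coarse_src X d g \<in> U i \<and> coarse_rng X d g \<in> U i} \<subseteq> P i"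
    by auto
  have "\<exists>S\<ge>0. P i \<subseteq> beta_set (entourage X d S)" if "i \<le> m" for i
  proof -
    have "compactin (coarse_arrows X d) (coarse_arrows X d closure_of P i)" "P i \<subseteq> coarse_set X d"
      using P(2)[OF that] by (simp_all add: precompact_in_def coarse_groupoid_def)
    then show ?thesis
      using closure_of_subset[of "P i" "coarse_arrows X d"]
      by (metis compactin_coarse_arrows_bounded order_trans topspace_coarse_arrows)
  qed
  then obtain s where s: "\<And>i. i \<le> m \<Longrightarrow> 0 \<le> s i \<and> P i \<subseteq> beta_set (entourage X d (s i))"
    by metis
  \<comment> \<open>Since all \<open>s i\<close> are nonnegative, their sum is a common
    bound.\<close>
  define S where "S = (\<Sum>i\<le>m. s i)"
  have sS: "s i \<le> S" if "i \<le> m" for i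
    unfolding S_def using s that by (intro member_le_sum) auto
  define V where "V i = {x \<in> X. beta_point (x, x) \<in> U i}" for i
  define H where "H i x y \<longleftrightarrow> x \<in> X \<and> y \<in> X \<and> beta_point (x, y) \<in> P i" for i x y
  note in_coarse = beta_point_in_coarse[OF metric]
  have src: "coarse_src X d (beta_point (x, y)) = beta_point (y, y)"
    and rng: "coarse_rng X d (beta_point (x, y)) = beta_point (x, x)"
    and inv: "coarse_inv X d (beta_point (x, y)) = beta_point (y, x)"
    and len: "coarse_length X d (beta_point (x, y)) = d x y" if "x \<in> X" "y \<in> X" for x y
    using in_coarse[OF that] coarse_length_extension(2)[OF metric that]
    by (simp_all add: coarse_src_eq[OF metric] coarse_rng_eq[OF metric] coarse_inv_eq[OF metric]
        coarse_length_def)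
  show thesis
  proof (rule that[of S V H])
    show "0 \<le> S" unfolding S_def using s by (intro sum_nonneg) auto
    show "X = (\<Union>i\<le>m. V i)"
    proof (intro equalityI subsetI)
      fix x assume x: "x \<in> X"
      then have "beta_point (x, x) \<in> (\<Union>i\<le>m. U i)" by (simp add: U entourage_def)
      then show "x \<in> (\<Union>i\<le>m. V i)" using x by (auto simp: V_def)
    qed (auto simp: V_def)
    show "H i x y" if "i \<le> m" "x \<in> V i" "y \<in> V i" "d x y < R" for i x y
    proof -
      have "x \<in> X" "y \<in> X" using that by (auto simp: V_def)
      then show ?thesis using P(3)[OF that(1)] that in_coarse[of x y]
        by (auto simp: H_def V_def src rng len)
    qed
    show "H i y x" if "i \<le> m" "H i x y" for i x y
      using P(1)[OF that(1)] that(2) inv[of x y]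
      by (auto simp: H_def subgroupoid_def coarse_groupoid_def)
    show "H i x z" if "i \<le> m" "H i x y" "H i y z" for i x y z
    proof -
      have X: "x \<in> X" "y \<in> X" "z \<in> X" using that by (auto simp: H_def)
      then have "coarse_mul X d (beta_point (x, y)) (beta_point (y, z)) = beta_point (x, z)"
        using coarse_mul_eq[OF metric bg in_coarse in_coarse] src rng coarse_comp_beta_point[OF metric]
        by simp
      moreover have "\<forall>g\<in>P i. \<forall>h\<in>P i. coarse_src X d g = coarse_rng X d h \<longrightarrow> coarse_mul X d g h \<in> P i"
        using P(1)[OF that(1)] by (simp add: subgroupoid_def coarse_groupoid_def)
      then have "coarse_mul X d (beta_point (x, y)) (beta_point (y, z)) \<in> P i"
        using that(2,3) src[of x y] rng[of y z] by (simp add: H_def)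
      ultimately show ?thesis using X by (simp add: H_def)
    qed
    show "x \<in> X \<and> y \<in> X \<and> d x y \<le> S" if "i \<le> m" "H i x y" for i x y
    proof -
      have "beta_point (x, y) \<in> beta_set (entourage X d (s i))"
        using s[OF that(1)] that(2) unfolding H_def by blast
      then show ?thesis using sS[OF that(1)] by (simp add: entourage_def)
    qed
  qed
qed

theorem corollary1p3:
  fixes X :: "'a set" and d :: "'a \<Rightarrow> 'a \<Rightarrow> real"
  assumes "Metric_space X d"
    and "Metric_space.mtopology X d = discrete_topology X"
    and "bounded_geometry X d"
    and "subexponential_dad_growth (coarse_groupoid X d) (coarse_length X d)"
  shows "amenable_groupoid (coarse_groupoid X d)"
proof (rule amenable_coarse_groupoidI[OF assms(1,3)])
  fix r e :: real
  assume r: "0 \<le> r" and e: "0 < e"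
  \<comment> \<open>This makes \<open>exp (c * r) \<le> 1 + e / 4\<close>; dividing by
    \<open>r + 1\<close> also covers \<open>r = 0\<close>.\<close>
  define c where "c = ln (1 + e / 4) / (r + 1)"
  have c: "0 < c" using r e by (simp add: c_def)
  have "c * r \<le> c * (r + 1)" using c by simp
  also have "\<dots> = ln (1 + e / 4)" using r by (simp add: c_def)
  finally have "exp (c * r) \<le> 1 + e / 4" using e by (simp add: ln_ge_iff)
  then have small: "4 * (exp (c * r) - 1) \<le> e" by simp
  \<comment> \<open>Only now, with \<open>c\<close> fixed by \<open>r\<close> and \<open>e\<close>,
    is the scale \<open>l\<close> chosen, and the cover is taken at the resulting scale
    \<open>2 * l + r\<close>.\<close>
  obtain l m U where l: "0 < l" and m: "real m + 2 \<le> exp (c * l)"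
    and U: "dad_cover (coarse_groupoid X d)
      {z \<in> topspace (arrows (coarse_groupoid X d)). coarse_length X d z < 2 * l + r} m U"
    by (rule subexponential_dad_growth_cover[OF assms(4) c r])
  show "\<exists>S\<ge>0. \<exists>\<mu>. reiter_weights X d r e S \<mu>"
  proof (rule dad_cover_decomposition[OF assms(1,3) U])
    fix S and V :: "nat \<Rightarrow> 'a set" and H
    assume S: "0 \<le> S" and dec: "X = (\<Union>i\<le>m. V i)"
      "\<And>i x y. i \<le> m \<Longrightarrow> x \<in> V i \<Longrightarrow> y \<in> V i \<Longrightarrow> d x y < 2 * l + r \<Longrightarrow> H i x y"
      "\<And>i x y. i \<le> m \<Longrightarrow> H i x y \<Longrightarrow> H i y x"
      "\<And>i x y z. i \<le> m \<Longrightarrow> H i x y \<Longrightarrow> H i y z \<Longrightarrow> H i x z"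
      "\<And>i x y. i \<le> m \<Longrightarrow> H i x y \<Longrightarrow> x \<in> X \<and> y \<in> X \<and> d x y \<le> S"
    have "\<exists>\<mu>. reiter_weights X d r e (l + S) \<mu>"
      by (rule Metric_space.decomposition_weights[where V = V and H = H, OF assms(1) less_imp_le[OF c] r small m]) (fact dec)+
    then show ?thesis
      using S l by (intro exI[of _ "l + S"]) auto
  qed
qed

end
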